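(* Let $d\ge 1$ and consider a random stratified environment $(p_n,q_n,r_n,\mu_n)_{n\in\mathbb Z}$, where $p_n,q_n,r_n>0$ with $p_n+q_n+r_n=1$ and $\mu_n$ is a probability measure on $\mathbb Z^d$. Assume that there is a (deterministic) $\eta>0$ such that for all $n\in\mathbb Z$: $\min\{p_n,q_n,r_n\}\ge\eta$; $\sum_{k\in\mathbb Z^d}\|k\|^{\max(d,3)}\mu_n(k)\le 1/\eta$; and the spectrum of the matrix $\sum_{k\in\mathbb Z^d}kk^{t}\mu_n(k)$ is included in $[\eta,+\infty)$. Suppose that $(p_n/q_n)_{n\in\mathbb Z}$ are i.i.d. random variables and that either $\mathbb E(\log(p_0/q_0))\ne 0$ or $d\ge 2$. Then for almost every realization of the environment, the Markov chain $(S_n)_{n\ge 0}$ on $\mathbb Z^d\times\mathbb Z$ associated with this environment is transient.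
   Context: Given an environment $(p_n,q_n,r_n,\mu_n)_{n\in\mathbb Z}$, the associated random walk is the Markov chain $(S_n)_{n\ge0}$ on $\mathbb Z^d\times\mathbb Z$ with $S_0=0$ and transition probabilities, for $(m,n)\in\mathbb Z^d\times\mathbb Z$ and $k\in\mathbb Z^d$: $(m,n)\to(m,n+1)$ with probability $p_n$; $(m,n)\to(m,n-1)$ with probability $q_n$; $(m,n)\to(m+k,n)$ with probability $r_n\mu_n(k)$. The transition laws thus depend only on the last coordinate. The probability and expectation $\mathbb P,\mathbb E$ refer to the randomness of the environment. The point of view is quenched: recurrence or transience is that of the Markov chain (i.e. of its starting point $0$) for a fixed realization of the environment. *)

theory Defs
  imports "HOL-Probability.Probability"
begin

section \<open>Markov chains\<close>

text \<open>
  A process \<open>S\<close> on a probability space \<open>N\<close> is a Markov chain with transition probabilities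
  \<open>P x y\<close> started at \<open>x0\<close>. The last clause is the Markov property
  \<open>P (S_{n+1} = x_{n+1} | S_0 = x_0, ..., S_n = x_n) = P x_n x_{n+1}\<close>, multiplied out so that
  conditioning events of probability \<open>0\<close> need no special treatment.
\<close>

definition markov_chain ::
  "'b measure \<Rightarrow> (nat \<Rightarrow> 'b \<Rightarrow> 's::countable) \<Rightarrow> ('s \<Rightarrow> 's \<Rightarrow> real) \<Rightarrow> 's \<Rightarrow> bool" where
  "markov_chain N S P x0 \<longleftrightarrow>
     prob_space N \<and>
     (\<forall>n. S n \<in> measurable N (count_space UNIV)) \<and>
     (AE \<omega> in N. S 0 \<omega> = x0) \<and>
     (\<forall>n (x :: nat \<Rightarrow> 's).
        measure N {\<omega> \<in> space N. \<forall>i\<le>Suc n. S i \<omega> = x i} =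
        measure N {\<omega> \<in> space N. \<forall>i\<le>n. S i \<omega> = x i} * P (x n) (x (Suc n)))"

text \<open>For a chain \<open>S\<close> started at \<open>x0\<close>: the probability of ever returning to \<open>x0\<close> is less than one.\<close>

definition transient_at :: "'b measure \<Rightarrow> (nat \<Rightarrow> 'b \<Rightarrow> 's) \<Rightarrow> 's \<Rightarrow> bool" where
  "transient_at N S x0 \<longleftrightarrow> measure N {\<omega> \<in> space N. \<exists>n\<ge>1. S n \<omega> = x0} < 1"


section \<open>Random walks in stratified environments\<close>

text \<open>The horizontal step \<open>k = 0\<close> is allowed; it leaves the walk in place.\<close>

definition strat_trans ::
  "(int \<Rightarrow> real) \<Rightarrow> (int \<Rightarrow> real) \<Rightarrow> (int \<Rightarrow> real) \<Rightarrow> (int \<Rightarrow> (int ^ 'd::finite) pmf)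
     \<Rightarrow> (int ^ 'd) \<times> int \<Rightarrow> (int ^ 'd) \<times> int \<Rightarrow> real" where
  "strat_trans p q r \<mu> = (\<lambda>(m, n) (m', n').
       (if m' = m \<and> n' = n + 1 then p n else 0)
     + (if m' = m \<and> n' = n - 1 then q n else 0)
     + (if n' = n then r n * pmf (\<mu> n) (m' - m) else 0))"

definition real_vec :: "int ^ 'd \<Rightarrow> real ^ 'd::finite" where
  "real_vec k = (\<chi> i. real_of_int (k $ i))"

definition second_moment_matrix :: "(int ^ 'd::finite) pmf \<Rightarrow> real ^ 'd ^ 'd" where
  "second_moment_matrix \<nu> =
     (\<chi> i j. \<Sum>\<^sub>\<infinity>k\<in>UNIV. real_vec k $ i * real_vec k $ j * pmf \<nu> k)"

text \<open>Set of real eigenvalues; it is only used for symmetric matrices, which have no others.\<close>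

definition matrix_spectrum :: "real ^ 'd ^ 'd::finite \<Rightarrow> real set" where
  "matrix_spectrum A = {c. \<exists>v. v \<noteq> 0 \<and> A *v v = c *s v}"


section \<open>Existence of the walk\<close>

text \<open>
  Every environment admits a walk in the sense of \<open>markov_chain\<close>, so statements quantifying over
  all such processes are not vacuous.
\<close>

lemma markov_chain_exists:
  fixes K :: "'s::countable \<Rightarrow> 's pmf"
  shows "\<exists>(N :: (nat \<times> 's \<Rightarrow> 's) measure) S. markov_chain N S (\<lambda>x y. pmf (K x) y) x0"
proof -
  define M where "M = (\<lambda>j :: nat \<times> 's. measure_pmf (K (snd j)))"
  interpret product_prob_space M UNIV
    unfolding product_prob_space_def product_sigma_finite_def product_prob_space_axioms_def
    by (auto simp: M_def prob_space_imp_sigma_finite measure_pmf.prob_space_axioms)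
  let ?N = "PiM UNIV M"
  define S where "S = (\<lambda>n \<omega>. rec_nat x0 (\<lambda>i s. \<omega> (i, s)) n)"
  have S0: "S 0 \<omega> = x0" and SS: "S (Suc n) \<omega> = \<omega> (n, S n \<omega>)" for n \<omega>
    by (simp_all add: S_def)
  have sp [simp]: "space ?N = UNIV"
    by (auto simp: space_PiM M_def PiE_def)
  have comp: "(\<lambda>\<omega>. \<omega> j) \<in> measurable ?N (count_space UNIV)" for j
  proof -
    have "(\<lambda>\<omega>. \<omega> j) \<in> measurable ?N (M j)" by (rule measurable_component_singleton) simp
    also have "measurable ?N (M j) = measurable ?N (count_space UNIV)"
      by (intro measurable_cong_sets) (simp_all add: M_def)
    finally show ?thesis .
  qed
  have meas: "S n \<in> measurable ?N (count_space UNIV)" for n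
  proof (induction n)
    case 0
    have "S 0 = (\<lambda>_. x0)" by (simp add: S0 fun_eq_iff)
    then show ?case by simp
  next
    case (Suc n)
    have "(\<lambda>\<omega>. (\<lambda>s \<omega>. \<omega> (n, s)) (S n \<omega>) \<omega>) \<in> measurable ?N (count_space UNIV)"
      by (rule measurable_compose_countable[OF comp Suc])
    moreover have "S (Suc n) = (\<lambda>\<omega>. \<omega> (n, S n \<omega>))" by (simp add: SS fun_eq_iff)
    ultimately show ?case by simp
  qed
  have path: "measure ?N {\<omega>. \<forall>i\<le>n. S i \<omega> = x i} =
      (if x 0 = x0 then \<Prod>i<n. pmf (K (x i)) (x (Suc i)) else 0)" for n x
  proof (cases "x 0 = x0")
    case False
    then have *: "{\<omega>. \<forall>i\<le>n. S i \<omega> = x i} = {}" using S0 by fastforce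
    show ?thesis unfolding * using False by simp
  next
    case True
    define J where "J = (\<lambda>i. (i, x i)) ` {..<n}"
    define X where "X = (\<lambda>j :: nat \<times> 's. {x (Suc (fst j))})"
    have iff: "(\<forall>i\<le>n. S i \<omega> = x i) \<longleftrightarrow> (\<forall>i<n. \<omega> (i, x i) = x (Suc i))" for \<omega>
    proof
      assume *: "\<forall>i\<le>n. S i \<omega> = x i"
      show "\<forall>i<n. \<omega> (i, x i) = x (Suc i)"
        using * SS by (metis Suc_leI less_imp_le)
    next
      assume *: "\<forall>i<n. \<omega> (i, x i) = x (Suc i)"
      have "i \<le> n \<Longrightarrow> S i \<omega> = x i" for i
        by (induction i) (use * True in \<open>auto simp: S0 SS\<close>)
      then show "\<forall>i\<le>n. S i \<omega> = x i" by blast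
    qed
    have "{\<omega>. \<forall>i\<le>n. S i \<omega> = x i} = prod_emb UNIV M J (Pi\<^sub>E J X)"
      unfolding iff by (auto simp: prod_emb_def J_def X_def M_def PiE_iff extensional_def restrict_def)
    also have "measure ?N \<dots> = (\<Prod>j\<in>J. measure (M j) (X j))"
      by (rule measure_PiM_emb) (auto simp: J_def M_def)
    also have "\<dots> = (\<Prod>i<n. pmf (K (x i)) (x (Suc i)))"
      unfolding J_def by (subst prod.reindex) (auto simp: inj_on_def M_def X_def measure_pmf_single)
    finally show ?thesis using True by simp
  qed
  have "markov_chain ?N S (\<lambda>x y. pmf (K x) y) x0"
    unfolding markov_chain_def using prob_space_axioms meas
    by (auto simp: S0 path)
  then show ?thesis by blast
qed

lemma strat_walk_exists:
  fixes \<mu> :: "int \<Rightarrow> (int ^ 'd::finite) pmf"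
  assumes "\<And>n. p n > 0" "\<And>n. q n > 0" "\<And>n. r n > 0" "\<And>n. p n + q n + r n = 1"
  shows "\<exists>(N :: (nat \<times> ((int ^ 'd) \<times> int) \<Rightarrow> (int ^ 'd) \<times> int) measure) S.
           markov_chain N S (strat_trans p q r \<mu>) (0, 0)"
proof -
  define K :: "(int ^ 'd) \<times> int \<Rightarrow> ((int ^ 'd) \<times> int) pmf" where
    "K = (\<lambda>(m, n). bind_pmf (bernoulli_pmf (r n)) (\<lambda>b.
       if b then map_pmf (\<lambda>k. (m + k, n)) (\<mu> n)
       else map_pmf (\<lambda>u. (m, if u then n + 1 else n - 1)) (bernoulli_pmf (p n / (p n + q n)))))"
  have "pmf (K (m, n)) (m', n') = strat_trans p q r \<mu> (m, n) (m', n')" for m n m' n'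
  proof -
    have r: "0 \<le> r n" "r n \<le> 1" and u: "0 \<le> p n / (p n + q n)" "p n / (p n + q n) \<le> 1"
      and nz: "p n + q n > 0" and r1: "1 - r n = p n + q n"
      using assms(1-4)[of n] by (auto simp: field_simps)
    have horiz: "pmf (map_pmf (\<lambda>k. (m + k, n)) (\<mu> n)) (m', n') =
        (if n' = n then pmf (\<mu> n) (m' - m) else 0)"
    proof (cases "n' = n")
      case True
      have "inj (\<lambda>k. (m + k, n))" by (auto simp: inj_on_def)
      from pmf_map_inj'[OF this, of "\<mu> n" "m' - m"] True show ?thesis by simp
    next
      case False
      then show ?thesis by (auto simp: pmf_eq_0_set_pmf)
    qed
    have vert: "pmf (map_pmf (\<lambda>u. (m, if u then n + 1 else n - 1))
          (bernoulli_pmf (p n / (p n + q n)))) (m', n') =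
        (if m' = m \<and> n' = n + 1 then p n / (p n + q n) else 0)
        + (if m' = m \<and> n' = n - 1 then q n / (p n + q n) else 0)" (is "pmf (map_pmf ?f ?B) _ = _")
    proof -
      have inj: "inj ?f" by (auto simp: inj_on_def split: if_splits)
      have q: "1 - p n / (p n + q n) = q n / (p n + q n)" using nz by (simp add: field_simps)
      consider "(m', n') = ?f True" | "(m', n') = ?f False" | "(m', n') \<notin> range ?f"
        unfolding image_iff by (metis (full_types))
      then show ?thesis
      proof cases
        case 1
        then show ?thesis using pmf_map_inj'[OF inj, of ?B True] u by simp
      next
        case 2
        then show ?thesis using pmf_map_inj'[OF inj, of ?B False] u q by simp
      next
        case 3
        then have "pmf (map_pmf ?f ?B) (m', n') = 0"
          by (auto simp: pmf_eq_0_set_pmf)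
        moreover have "\<not> (m' = m \<and> n' = n + 1)" "\<not> (m' = m \<and> n' = n - 1)"
          using 3 by (simp_all add: image_iff) (metis (full_types))+
        ultimately show ?thesis by auto
      qed
    qed
    show ?thesis
      unfolding K_def prod.case pmf_bind strat_trans_def
      using r nz by (auto simp: horiz vert r1)
  qed
  then have "(\<lambda>x y. pmf (K x) y) = strat_trans p q r \<mu>"
    by (auto simp: fun_eq_iff)
  with markov_chain_exists[of K "(0, 0)"] show ?thesis by simp
qed

end

theory Submission
  imports Defs
begin

text \<open>
  If the return probabilities of the walk are summable, decomposing at the last visit shows that it is
  transient. A Fourier transform in the horizontal variable turns the Green function at frequency \<open>v\<close> into
  a function on the vertical line whose modulus is dominated by the Green function of a nearest neighbour
  walk killed at a rate of order \<open>\<bar>v\<bar>\<^sup>2\<close> (and not killed at all for \<open>v = 0\<close>). The latter is bounded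
  through the electrical resistance \<open>D\<^sub>n = \<Prod>i=1..n. q\<^sub>i / p\<^sub>i\<close>.

  If \<open>E ln (p\<^sub>0 / q\<^sub>0) \<noteq> 0\<close>, Hoeffding's inequality makes the total resistance to the right or to the left
  finite almost surely, and frequency \<open>0\<close> suffices. If the expectation is \<open>0\<close> and \<open>d \<ge> 2\<close>, the return
  probability is averaged over a two-dimensional grid of frequencies, where the frequencies of size about
  \<open>2\<^sup>-\<^sup>m\<close> have proportion about \<open>4\<^sup>-\<^sup>m\<close>. It is enough to gain a summable factor over the trivial bound
  \<open>4\<^sup>m\<close> on the Green function at this scale. When \<open>p\<^sub>i = q\<^sub>i\<close> almost surely, averaging the resistance bound
  over \<open>2\<^sup>m\<close> points gains \<open>2\<^sup>-\<^sup>m\<close>. Otherwise \<open>- ln D\<^sub>n\<close> is a centered random walk, whose maximum up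
  to time \<open>n\<close> eventually exceeds \<open>2 ln n\<close>, and at such a point with \<open>n\<close> of order \<open>m\<close> the gain is \<open>m\<^sup>-\<^sup>2\<close>.
\<close>

section \<open>Transience from a summable Green function\<close>

text \<open>The starting point is not an entry of the list, so a return to \<open>x\<close> is
  membership of \<open>x\<close> in the list and the position reached is
  \<open>last (x # l)\<close>.\<close>

primrec path_pmf :: "('s \<Rightarrow> 's pmf) \<Rightarrow> nat \<Rightarrow> 's \<Rightarrow> 's list pmf" where
  "path_pmf K 0 x = return_pmf []"
| "path_pmf K (Suc n) x = bind_pmf (K x) (\<lambda>y. map_pmf ((#) y) (path_pmf K n y))"

primrec step_law :: "('s \<Rightarrow> 's pmf) \<Rightarrow> 's \<Rightarrow> nat \<Rightarrow> 's pmf" where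
  "step_law K x 0 = return_pmf x"
| "step_law K x (Suc n) = bind_pmf (step_law K x n) K"

lemma measure_bind_pmf: "measure (bind_pmf M f) X = (\<integral>x. measure (f x) X \<partial>M)"
  unfolding measure_pmf_bind
  by (rule measure_pmf.measure_bind[where N = "count_space UNIV"]) (auto simp: measure_subprob)

lemma length_path_pmf: "l \<in> set_pmf (path_pmf K n x) \<Longrightarrow> length l = n"
  by (induction n arbitrary: x l) auto

text \<open>The Markov property at time \<open>n\<close>, which later allows a path to be cut at its
  last visit to the start.\<close>

lemma path_pmf_add:
  "path_pmf K (n + m) x =
     bind_pmf (path_pmf K n x) (\<lambda>l. map_pmf ((@) l) (path_pmf K m (last (x # l))))"
proof (induction n arbitrary: x)
  case 0
  have "((@) ([] :: 'a list)) = (\<lambda>l. l)" by auto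
  then show ?case by (simp add: bind_return_pmf map_pmf_ident)
next
  case (Suc n)
  have app: "(@) (y # l) = (\<lambda>l'. y # l @ l')" for y :: 'a and l by auto
  have "path_pmf K (Suc n + m) x = bind_pmf (K x) (\<lambda>y. map_pmf ((#) y)
          (bind_pmf (path_pmf K n y) (\<lambda>l. map_pmf ((@) l) (path_pmf K m (last (y # l))))))"
    by (simp add: Suc)
  also have "\<dots> = bind_pmf (path_pmf K (Suc n) x)
       (\<lambda>l. map_pmf ((@) l) (path_pmf K m (last (x # l))))"
    by (simp add: map_bind_pmf bind_assoc_pmf bind_map_pmf pmf.map_comp o_def app del: append.append_Cons)
  finally show ?case .
qed

lemma last_path_pmf: "map_pmf (\<lambda>l. last (x # l)) (path_pmf K n x) = step_law K x n"
proof (induction n)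
  case (Suc n)
  have "path_pmf K (Suc n) x = path_pmf K (n + 1) x" by simp
  also have "map_pmf (\<lambda>l. last (x # l)) \<dots> =
      bind_pmf (path_pmf K n x) (\<lambda>l. K (last (x # l)))"
    unfolding path_pmf_add
    by (simp add: map_bind_pmf pmf.map_comp o_def bind_return_pmf' map_pmf_def[symmetric]
        last_append bind_assoc_pmf bind_return_pmf)
  also have "\<dots> = step_law K x (Suc n)"
    by (simp add: Suc[symmetric] bind_map_pmf)
  finally show ?case .
qed simp

lemma pmf_path_pmf:
  "pmf (path_pmf K (length l) x) l = (\<Prod>i<length l. pmf (K ((x # l) ! i)) (l ! i))"
proof (induction l arbitrary: x)
  case (Cons y l)
  have "pmf (path_pmf K (Suc (length l)) x) (y # l) =
      (\<integral>z. pmf (map_pmf ((#) z) (path_pmf K (length l) z)) (y # l) \<partial>K x)"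
    by (simp add: pmf_bind)
  also have "\<dots> = (\<integral>z. indicator {y} z * pmf (path_pmf K (length l) y) l \<partial>K x)"
  proof (intro Bochner_Integration.integral_cong refl)
    fix z
    show "pmf (map_pmf ((#) z) (path_pmf K (length l) z)) (y # l) =
        indicator {y} z * pmf (path_pmf K (length l) y) l"
    proof (cases "z = y")
      case True
      then show ?thesis using pmf_map_inj'[of "(#) y" "path_pmf K (length l) y" l] by simp
    next
      case False
      then show ?thesis by (auto simp: pmf_eq_0_set_pmf)
    qed
  qed
  also have "\<dots> = pmf (K x) y * pmf (path_pmf K (length l) y) l"
    by (simp add: measure_pmf_single)
  also have "\<dots> = (\<Prod>i<length (y # l). pmf (K ((x # y # l) ! i)) ((y # l) ! i))"
    by (simp add: Cons lessThan_Suc_eq_insert_0 prod.reindex[of Suc] prod.insert del: lessThan_Suc)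
  finally show ?case by simp
qed simp

section \<open>Finite-dimensional laws of a Markov chain\<close>

lemma markov_chain_path:
  assumes mc: "markov_chain N S (\<lambda>x y. pmf (K x) y) x0"
  shows "measure N {\<omega> \<in> space N. \<forall>i\<le>n. S i \<omega> = x i} =
    (if x 0 = x0 then \<Prod>i<n. pmf (K (x i)) (x (Suc i)) else 0)"
proof (induction n)
  case 0
  interpret N: prob_space N using mc by (simp add: markov_chain_def)
  have [measurable]: "S 0 \<in> measurable N (count_space UNIV)"
    and ae: "AE \<omega> in N. S 0 \<omega> = x0"
    using mc by (auto simp: markov_chain_def)
  have "measure N {\<omega> \<in> space N. S 0 \<omega> = x 0} = (if x 0 = x0 then 1 else 0)"
    using ae
    by (auto simp: N.prob_Collect_eq_1 N.prob_Collect_eq_0 intro!: N.prob_eq_0_AE elim: AE_mp)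
  then show ?case by simp
next
  case (Suc n)
  have "measure N {\<omega> \<in> space N. \<forall>i\<le>Suc n. S i \<omega> = x i} =
      measure N {\<omega> \<in> space N. \<forall>i\<le>n. S i \<omega> = x i} * pmf (K (x n)) (x (Suc n))"
    using mc by (simp add: markov_chain_def)
  then show ?case by (simp add: Suc)
qed

text \<open>Moves events with a finite time horizon from the arbitrary space \<open>N\<close> to
  \<open>path_pmf\<close>. Lists over a countable type are countable, so it suffices to compare
  singletons, where both sides are products of transition probabilities.\<close>

lemma markov_chain_distr:
  fixes S :: "nat \<Rightarrow> 'b \<Rightarrow> 's::countable"
  assumes mc: "markov_chain N S (\<lambda>x y. pmf (K x) y) x0"
  shows "measure N {\<omega> \<in> space N. map (\<lambda>i. S (Suc i) \<omega>) [0..<n] \<in> A} =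
    measure (path_pmf K n x0) A"
proof -
  interpret N: prob_space N using mc by (simp add: markov_chain_def)
  have S [measurable]: "S n \<in> measurable N (count_space UNIV)" for n
    using mc by (simp add: markov_chain_def)
  have ae: "AE \<omega> in N. S 0 \<omega> = x0"
    using mc by (simp add: markov_chain_def)
  define h where "h = (\<lambda>\<omega>. map (\<lambda>i. S (Suc i) \<omega>) [0..<n])"
  have hl: "h \<omega> = l \<longleftrightarrow> length l = n \<and> (\<forall>i<n. S (Suc i) \<omega> = l ! i)" for l \<omega>
    by (auto simp: h_def list_eq_iff_nth_eq)
  have h [measurable]: "h \<in> measurable N (count_space UNIV)"
  proof (rule measurable_count_space_eq2_countable[THEN iffD2], safe)
    fix l :: "'s list"
    have "h -` {l} \<inter> space N = {\<omega> \<in> space N. length l = n \<and> (\<forall>i<n. S (Suc i) \<omega> = l ! i)}"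
      using hl by auto
    also have "\<dots> \<in> sets N" by measurable
    finally show "h -` {l} \<inter> space N \<in> sets N" .
  qed simp_all
  have "distr N (count_space UNIV) h = measure_pmf (path_pmf K n x0)"
  proof (rule measure_eqI_countable[of _ UNIV])
    fix l :: "'s list"
    have "emeasure (distr N (count_space UNIV) h) {l} = emeasure N (h -` {l} \<inter> space N)"
      by (simp add: emeasure_distr)
    also have "\<dots> = ennreal (measure N (h -` {l} \<inter> space N))"
      by (simp add: N.emeasure_eq_measure)
    also have "measure N (h -` {l} \<inter> space N) = pmf (path_pmf K n x0) l"
    proof (cases "length l = n")
      case True
      have "measure N (h -` {l} \<inter> space N) =
          measure N {\<omega> \<in> space N. \<forall>i\<le>n. S i \<omega> = (x0 # l) ! i}"
      proof (rule N.finite_measure_eq_AE)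
        show "AE \<omega> in N. (\<omega> \<in> h -` {l} \<inter> space N) =
            (\<omega> \<in> {\<omega> \<in> space N. \<forall>i\<le>n. S i \<omega> = (x0 # l) ! i})"
          using ae
        proof eventually_elim
          case (elim \<omega>)
          have "(\<forall>i<n. S (Suc i) \<omega> = l ! i) \<longleftrightarrow> (\<forall>i\<le>n. S i \<omega> = (x0 # l) ! i)"
            using elim by (auto simp: nth_Cons split: nat.splits)
          then show ?case using True hl by auto
        qed
      qed measurable
      also have "\<dots> = (\<Prod>i<n. pmf (K ((x0 # l) ! i)) (l ! i))"
        using markov_chain_path[OF mc, of n "\<lambda>i. (x0 # l) ! i"] by simp
      finally show ?thesis using pmf_path_pmf[of K l x0] True by simp
    next
      case False
      then have "h -` {l} = {}" using hl by auto
      moreover have "pmf (path_pmf K n x0) l = 0"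
        using False length_path_pmf by (fastforce simp: pmf_eq_0_set_pmf)
      ultimately show ?thesis by simp
    qed
    finally show "emeasure (distr N (count_space UNIV) h) {l} =
        emeasure (measure_pmf (path_pmf K n x0)) {l}"
      by (simp add: emeasure_pmf_single)
  qed auto
  then have "measure (distr N (count_space UNIV) h) A = measure (path_pmf K n x0) A" by simp
  then have "measure N (h -` A \<inter> space N) = measure (path_pmf K n x0) A"
    by (simp add: measure_distr)
  moreover have "h -` A \<inter> space N = {\<omega> \<in> space N. h \<omega> \<in> A}" by auto
  ultimately show ?thesis by (simp add: h_def)
qed

text \<open>Dominated convergence for series: each term tends to \<open>0\<close> and is dominated
  by the summable \<open>a\<close>.\<close>

lemma convolution_tendsto_0:
  fixes a u :: "nat \<Rightarrow> real"
  assumes a: "summable a" "\<And>n. a n \<ge> 0" and u: "u \<longlonglongrightarrow> 0" "\<And>n. 0 \<le> u n" "\<And>n. u n \<le> 1"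
  shows "(\<lambda>n. \<Sum>i\<le>n. a i * u (n - i)) \<longlonglongrightarrow> 0"
proof -
  have "(\<lambda>n. \<Sum>i. if i \<le> n then a i * u (n - i) else 0) \<longlonglongrightarrow> (\<Sum>i::nat. 0 :: real)"
  proof (rule tannerys_theorem[where M = a, THEN conjunct2, THEN conjunct2])
    show "((\<lambda>n. if i \<le> n then a i * u (n - i) else 0) \<longlongrightarrow> 0) sequentially" for i
    proof -
      have "(\<lambda>n. u (n - i)) \<longlonglongrightarrow> 0"
        by (rule LIMSEQ_offset[where k = i]) (use u(1) in simp)
      then have "(\<lambda>n. a i * u (n - i)) \<longlonglongrightarrow> 0" by (rule tendsto_mult_right_zero)
      moreover have "eventually (\<lambda>n. a i * u (n - i) = (if i \<le> n then a i * u (n - i) else 0)) sequentially"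
        using eventually_ge_at_top[of i] by eventually_elim simp
      ultimately show ?thesis by (rule Lim_transform_eventually)
    qed
    show "\<forall>\<^sub>F (i, n) in at_top \<times>\<^sub>F sequentially. norm (if i \<le> n then a i * u (n - i) else 0) \<le> a i"
      by (intro always_eventually) (auto simp: abs_mult a u mult_left_le)
  qed (use a in auto)
  moreover have "(\<Sum>i. if i \<le> n then a i * u (n - i) else 0) = (\<Sum>i\<le>n. a i * u (n - i))" for n
    by (subst suminf_finite[of "{..n}"]) auto
  ultimately show ?thesis by simp
qed

text \<open>Decomposing at the last visit to \<open>x0\<close> before time \<open>n\<close> gives \<open>1 \<le> \<Sum>i\<le>n. a i * u (n - i)\<close>, with
  \<open>a\<close> the return probabilities and \<open>u m\<close> the probability of no return up to time \<open>m\<close>.\<close>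

lemma transient_if_summable:
  fixes S :: "nat \<Rightarrow> 'b \<Rightarrow> 's::countable"
  assumes mc: "markov_chain N S (\<lambda>x y. pmf (K x) y) x0"
    and sm: "summable (\<lambda>n. pmf (step_law K x0 n) x0)"
  shows "transient_at N S x0"
proof (rule ccontr)
  assume nt: "\<not> transient_at N S x0"
  interpret N: prob_space N using mc by (simp add: markov_chain_def)
  have S [measurable]: "S n \<in> measurable N (count_space UNIV)" for n
    using mc by (simp add: markov_chain_def)
  define u where "u n = measure (path_pmf K n x0) {l. x0 \<notin> set l}" for n
  define a where "a n = pmf (step_law K x0 n) x0" for n
  define E where "E n = {\<omega> \<in> space N. \<exists>i\<in>{1..n}. S i \<omega> = x0}" for n
  have Em: "E n \<in> sets N" for n unfolding E_def by measurable
  have "x0 \<notin> set (map (\<lambda>i. S (Suc i) \<omega>) [0..<n]) \<longleftrightarrow> \<not> (\<exists>i\<in>{1..n}. S i \<omega> = x0)" for n \<omega>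
  proof -
    have "{1..n} = Suc ` {0..<n}" by (auto simp: image_Suc_atLeastLessThan)
    then show ?thesis by (auto simp del: image_Suc_atLeastLessThan)
  qed
  then have cE: "{\<omega> \<in> space N. map (\<lambda>i. S (Suc i) \<omega>) [0..<n] \<in> {l. x0 \<notin> set l}} = space N - E n" for n
    unfolding E_def by blast
  have uE: "u n = 1 - measure N (E n)" for n
    unfolding u_def markov_chain_distr[OF mc, symmetric] cE by (rule N.prob_compl[OF Em])
  have "(\<lambda>n. measure N (E n)) \<longlonglongrightarrow> measure N (\<Union>n. E n)"
  proof (rule N.finite_Lim_measure_incseq)
    show "incseq E" unfolding incseq_def E_def by fastforce
  qed (use Em in auto)
  moreover have "(\<Union>n. E n) = {\<omega> \<in> space N. \<exists>n\<ge>1. S n \<omega> = x0}" by (force simp: E_def)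
  \<comment> \<open>Without transience a return has probability \<open>1\<close>, so
    \<open>u n\<close> tends to \<open>0\<close>; the limit of the convolution then contradicts its
    lower bound \<open>1\<close>.\<close>
  moreover have "measure N {\<omega> \<in> space N. \<exists>n\<ge>1. S n \<omega> = x0} = 1"
    using nt N.prob_le_1[of "{\<omega> \<in> space N. \<exists>n\<ge>1. S n \<omega> = x0}"] unfolding transient_at_def by linarith
  ultimately have "(\<lambda>n. measure N (E n)) \<longlonglongrightarrow> 1" by simp
  then have "(\<lambda>n. 1 - measure N (E n)) \<longlonglongrightarrow> 1 - 1" by (intro tendsto_intros)
  then have u0: "u \<longlonglongrightarrow> 0" by (simp add: uE[abs_def])
  have conv: "(\<lambda>n. \<Sum>i\<le>n. a i * u (n - i)) \<longlonglongrightarrow> 0"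
  proof (rule convolution_tendsto_0[OF _ _ u0])
    show "summable a" using sm by (simp add: a_def[abs_def])
  qed (simp_all add: a_def u_def)
  have "1 \<le> (\<Sum>i\<le>n. a i * u (n - i))" for n
  proof -
    \<comment> \<open>\<open>V i\<close> is the event that the last visit to \<open>x0\<close>
      occurs at time \<open>i\<close>. Time \<open>0\<close> counts as a visit, hence every path of
      length \<open>n\<close> lies in some \<open>V i\<close> with \<open>i \<le> n\<close>.\<close>
    define V where "V i = {l. last (x0 # take i l) = x0 \<and> x0 \<notin> set (drop i l)}" for i
    have Vi: "measure (path_pmf K n x0) (V i) = a i * u (n - i)" if "i \<le> n" for i
    proof -
      have "path_pmf K n x0 = path_pmf K (i + (n - i)) x0" using that by simp
      also have "measure \<dots> (V i) = (\<integral>l. measure (map_pmf ((@) l) (path_pmf K (n - i) (last (x0 # l)))) (V i)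
          \<partial>path_pmf K i x0)"
        unfolding path_pmf_add
        by (rule measure_bind_pmf)
      also have "\<dots> = (\<integral>l. indicator {l. last (x0 # l) = x0} l * u (n - i) \<partial>path_pmf K i x0)"
      proof (intro integral_cong_AE AE_pmfI)
        fix l assume "l \<in> set_pmf (path_pmf K i x0)"
        then have "length l = i" by (rule length_path_pmf)
        then have "(@) l -` V i = (if last (x0 # l) = x0 then {l. x0 \<notin> set l} else {})"
          by (auto simp: V_def)
        then show "measure (map_pmf ((@) l) (path_pmf K (n - i) (last (x0 # l)))) (V i) =
            indicator {l. last (x0 # l) = x0} l * u (n - i)"
          by (simp add: u_def measure_map_pmf split: if_splits)
      qed auto
      also have "\<dots> = measure (path_pmf K i x0) {l. last (x0 # l) = x0} * u (n - i)"
        by simp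
      also have "measure (path_pmf K i x0) {l. last (x0 # l) = x0} = a i"
        unfolding a_def last_path_pmf[symmetric] by (simp add: pmf_map vimage_def)
      finally show ?thesis .
    qed
    have "{l. length l = n} \<subseteq> (\<Union>i\<in>{..n}. V i)"
    proof
      fix l :: "'s list" assume "l \<in> {l. length l = n}"
      then have len: "length l = n" by simp
      define P where "P i \<longleftrightarrow> last (x0 # take i l) = x0" for i
      define j where "j = (GREATEST i. i \<le> n \<and> P i)"
      have "0 \<le> n \<and> P 0" by (simp add: P_def)
      then have j: "j \<le> n \<and> P j" unfolding j_def by (rule GreatestI_nat[where b = n]) auto
      have jg: "i \<le> j" if "i \<le> n" "P i" for i
        unfolding j_def by (rule Greatest_le_nat[where b = n]) (use that in auto)
      have "x0 \<notin> set (drop j l)"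
      proof
        assume "x0 \<in> set (drop j l)"
        then obtain i where i: "i < length (drop j l)" "drop j l ! i = x0"
          by (metis in_set_conv_nth)
        \<comment> \<open>Entry \<open>j + i\<close> of the list is the position at time
          \<open>Suc (j + i)\<close>, which would be a visit later than the last one.\<close>
        then have "P (Suc (j + i))" using len by (simp add: P_def take_Suc_conv_app_nth)
        moreover have "Suc (j + i) \<le> n" using i len by auto
        ultimately show False using jg[of "Suc (j + i)"] by simp
      qed
      with j show "l \<in> (\<Union>i\<in>{..n}. V i)"
        using len by (auto simp: V_def P_def simp del: last.simps intro!: bexI[of _ j])
    qed
    moreover have "measure (path_pmf K n x0) {l. length l = n} = 1"
      by (rule measure_pmf.prob_eq_1[THEN iffD2]) (auto intro!: AE_pmfI length_path_pmf)
    ultimately have "1 \<le> measure (path_pmf K n x0) (\<Union>i\<in>{..n}. V i)"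
      using measure_pmf.finite_measure_mono[of "{l. length l = n}" "\<Union>i\<in>{..n}. V i"
          "path_pmf K n x0"] by simp
    also have "\<dots> \<le> (\<Sum>i\<le>n. measure (path_pmf K n x0) (V i))"
      by (rule measure_pmf.finite_measure_subadditive_finite) auto
    finally show ?thesis using Vi by simp
  qed
  then have "1 \<le> (0::real)" by (intro LIMSEQ_le_const[OF conv]) auto
  then show False by simp
qed

section \<open>A killed nearest neighbour flow on the integers\<close>

text \<open>Resistance of the edge from \<open>n\<close> to \<open>n + 1\<close> in units of that of
  the edge from \<open>0\<close> to \<open>1\<close>.\<close>

definition resistance :: "(int \<Rightarrow> real) \<Rightarrow> (int \<Rightarrow> real) \<Rightarrow> nat \<Rightarrow> real" where
  "resistance p q n = (\<Prod>i=1..n. q (int i) / p (int i))"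

lemma resistance_0 [simp]: "resistance p q 0 = 1"
  by (simp add: resistance_def)

lemma resistance_Suc: "resistance p q (Suc n) = resistance p q n * (q (int (Suc n)) / p (int (Suc n)))"
  by (simp add: resistance_def)

text \<open>\<open>g\<close> plays the modulus of a Green function with pole at \<open>0\<close> for
  a walk killed at rate \<open>w\<close>. An inequality replaces the Green equation because moduli
  are taken; the limits at both ends stand in for boundary conditions.\<close>

locale killed_flow =
  fixes p q g :: "int \<Rightarrow> real" and w :: real
  assumes p: "0 < p y" "p y \<le> 1" and q: "0 < q y" "q y \<le> 1" and g: "0 \<le> g y" and w: "0 \<le> w"
    and ineq: "(p y + q y + w) * g y \<le> (if y = 0 then 1 else 0) + p (y - 1) * g (y - 1) + q (y + 1) * g (y + 1)"
    and lim1: "(\<lambda>n. g (int n)) \<longlonglongrightarrow> 0" and lim2: "(\<lambda>n. g (- int n)) \<longlonglongrightarrow> 0"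
begin

text \<open>The net current through the edge from \<open>j\<close> to \<open>j + 1\<close>.\<close>

definition flow :: "int \<Rightarrow> real" where "flow j = p j * g j - q (j + 1) * g (j + 1)"

lemma flow_step: "flow j \<le> flow (j - 1) + (if j = 0 then 1 else 0) - w * g j"
  using ineq[of j] by (simp add: flow_def algebra_simps)

lemma flow_abs: "\<bar>flow j\<bar> \<le> g j + g (j + 1)"
proof -
  have "p j * g j \<le> g j" "q (j + 1) * g (j + 1) \<le> g (j + 1)" "0 \<le> p j * g j" "0 \<le> q (j + 1) * g (j + 1)"
    using p[of j] q[of "j + 1"] g[of j] g[of "j + 1"]
    by (auto intro: mult_left_le_one_le mult_nonneg_nonneg)
  then show ?thesis unfolding flow_def by linarith
qed

text \<open>Left of the source the flow cannot decrease as the edge moves further left, and it tends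
  to \<open>0\<close> there because \<open>g\<close> does.\<close>

lemma flow_neg: "flow (- 1) \<le> 0"
proof -
  have dec: "flow (- 1) \<le> flow (- 1 - int n)" for n
  proof (induction n)
    case (Suc n)
    have "flow (- 1 - int n) \<le> flow (- 1 - int (Suc n))"
      using flow_step[of "- 1 - int n"] mult_nonneg_nonneg[OF w g, of "- 1 - int n"]
      by (simp add: algebra_simps)
    with Suc show ?case by linarith
  qed simp
  have "flow (- 1) \<le> g (- int (Suc n)) + g (- int n)" for n
    using dec[of n] flow_abs[of "- 1 - int n"] by (simp add: algebra_simps)
  moreover have "(\<lambda>n. g (- int (Suc n)) + g (- int n)) \<longlonglongrightarrow> 0 + 0"
    using lim2 LIMSEQ_Suc[OF lim2] by (intro tendsto_add) auto
  ultimately show ?thesis by (metis (no_types, lifting) LIMSEQ_le_const add_0)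
qed

text \<open>Conservation of mass: the source at \<open>0\<close> supplies one unit, nothing enters
  from the left by \<open>flow_neg\<close>, and each site \<open>j\<close> in \<open>1..n\<close>
  loses at least \<open>w * g (int j)\<close>.\<close>

lemma flow_decreasing: "flow (int n) + w * (\<Sum>j=1..n. g (int j)) \<le> 1"
proof (induction n)
  case 0
  then show ?case using flow_step[of 0] flow_neg mult_nonneg_nonneg[OF w g, of 0] by simp
next
  case (Suc n)
  then show ?case using flow_step[of "int (Suc n)"] by (simp add: algebra_simps)
qed

text \<open>Right of the source the flow is nonincreasing, and its limit is
  \<open>0\<close>.\<close>

lemma flow_nonneg: "0 \<le> flow (int n)"
proof -
  have dec: "flow (int (n + k)) \<le> flow (int n)" for k
  proof (induction k)
    case (Suc k)
    have "flow (int (n + Suc k)) \<le> flow (int (n + k))"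
      using flow_step[of "int (n + Suc k)"] mult_nonneg_nonneg[OF w g, of "int (n + Suc k)"]
      by (simp add: algebra_simps)
    with Suc show ?case by linarith
  qed simp
  have "- (g (int (k + n)) + g (int (Suc k + n))) \<le> flow (int n)" for k
    using dec[of k] flow_abs[of "int (n + k)"] by (simp add: algebra_simps)
  moreover have "(\<lambda>k. - (g (int (k + n)) + g (int (Suc k + n)))) \<longlonglongrightarrow> - (0 + 0)"
    using LIMSEQ_ignore_initial_segment[OF lim1, of n]
      LIMSEQ_ignore_initial_segment[OF LIMSEQ_Suc[OF lim1], of n]
    by (intro tendsto_add tendsto_minus) auto
  ultimately show ?thesis by (metis (no_types, lifting) LIMSEQ_le_const2 add_0 neg_equal_zero)
qed

lemma flow_le_1: "flow (int n) \<le> 1"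
  using flow_decreasing[of n] mult_nonneg_nonneg[OF w sum_nonneg[of "{1..n}" "\<lambda>j. g (int j)"]] g
  by force

lemma killed_sum_le: "w * (\<Sum>j=1..n. g (int j)) \<le> 1"
  using flow_decreasing[of n] flow_nonneg[of n] by linarith

lemma resistance_pos: "0 < resistance p q n"
  unfolding resistance_def using p(1) q(1) by (intro prod_pos) auto

text \<open>Ohm's law: \<open>resistance p q n * p (int n) * g (int n)\<close> acts as a voltage,
  and across one edge it drops by resistance times flow. The flow is at most \<open>1\<close>, and
  the drops telescope.\<close>

lemma green_le:
  "p 0 * g 0 \<le> (\<Sum>j<n. resistance p q j) + resistance p q n * p (int n) * g (int n)"
proof (induction n)
  case (Suc n)
  let ?D = "resistance p q"
  have "?D n * p (int n) * g (int n) = ?D n * flow (int n) + ?D n * (q (int n + 1) * g (int n + 1))"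
    by (simp add: flow_def algebra_simps)
  also have "\<dots> \<le> ?D n + ?D n * (q (int n + 1) * g (int n + 1))"
    using flow_le_1[of n] resistance_pos[of n] by (simp add: mult_left_le)
  also have "?D n * (q (int n + 1) * g (int n + 1)) = ?D (Suc n) * p (int (Suc n)) * g (int (Suc n))"
    using p(1)[of "int (Suc n)"] by (simp add: resistance_Suc algebra_simps)
  finally show ?case using Suc by simp
qed simp

lemma green_le_resistance:
  "p 0 * g 0 \<le> (\<Sum>j<n. resistance p q j) + resistance p q n * g (int n)"
proof -
  have "resistance p q n * p (int n) * g (int n) \<le> resistance p q n * g (int n)"
    using p[of "int n"] resistance_pos[of n] g[of "int n"]
    by (intro mult_right_mono) (auto intro: mult_left_le)
  then show ?thesis using green_le[of n] by linarith
qed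

text \<open>As \<open>n\<close> grows both factors of the boundary term tend to
  \<open>0\<close>.\<close>

lemma green_le_total_resistance:
  assumes "summable (resistance p q)"
  shows "p 0 * g 0 \<le> (\<Sum>n. resistance p q n)"
proof -
  have "(\<lambda>n. (\<Sum>j<n. resistance p q j) + resistance p q n * g (int n))
      \<longlonglongrightarrow> (\<Sum>n. resistance p q n) + 0 * 0"
    by (intro tendsto_add tendsto_mult summable_LIMSEQ summable_LIMSEQ_zero assms lim1)
  then show ?thesis using green_le_resistance by (intro LIMSEQ_le_const) auto
qed

end

section \<open>Fourier transform in the horizontal direction\<close>

lemma integral_bind_pmf_real:
  fixes f :: "'a \<Rightarrow> real"
  assumes "\<And>x. \<bar>f x\<bar> \<le> B"
  shows "(\<integral>x. f x \<partial>bind_pmf M N) = (\<integral>x. (\<integral>y. f y \<partial>N x) \<partial>M)"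
  unfolding measure_pmf_bind
  by (rule integral_bind[where K = "count_space UNIV" and B = B and B' = 1])
     (use assms measurable_measure_pmf[of N] measure_pmf.emeasure_space_1
       in \<open>auto intro: measure_pmf.finite_measure_axioms\<close>)

lemma integrable_pmf_bounded:
  fixes f :: "'a \<Rightarrow> 'b::{banach, second_countable_topology}"
  assumes "\<And>x. norm (f x) \<le> B"
  shows "integrable (measure_pmf M) f"
  by (rule measure_pmf.integrable_const_bound[where B = B]) (auto simp: assms)

lemma norm_integral_pmf_le:
  fixes f :: "'a \<Rightarrow> 'b::{banach, second_countable_topology}"
  assumes "\<And>x. norm (f x) \<le> B"
  shows "norm (\<integral>x. f x \<partial>measure_pmf M) \<le> B"
proof -
  have "norm (\<integral>x. f x \<partial>measure_pmf M) \<le> (\<integral>x. norm (f x) \<partial>measure_pmf M)"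
    by (rule integral_norm_bound)
  also have "\<dots> \<le> (\<integral>x. B \<partial>measure_pmf M)"
    by (intro integral_mono integrable_pmf_bounded[where B = B])
       (auto simp: assms intro: order_trans[OF norm_ge_zero assms])
  finally show ?thesis by simp
qed

lemma integral_complex_parts:
  fixes f :: "'a \<Rightarrow> complex"
  assumes "\<And>x. norm (f x) \<le> B"
  shows "Re (\<integral>x. f x \<partial>measure_pmf M) = (\<integral>x. Re (f x) \<partial>measure_pmf M)"
    and "Im (\<integral>x. f x \<partial>measure_pmf M) = (\<integral>x. Im (f x) \<partial>measure_pmf M)"
  using integrable_pmf_bounded[where f = f, OF assms] by auto

text \<open>In each finite partial sum \<open>s\<close> can be sent to \<open>1\<close> by
  continuity, and the bound does not depend on \<open>N\<close>.\<close>

lemma summable_of_Abel_bound: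
  fixes a :: "nat \<Rightarrow> real"
  assumes "\<And>n. 0 \<le> a n" "\<And>s N. 0 < s \<Longrightarrow> s < 1 \<Longrightarrow> (\<Sum>n<N. s ^ n * a n) \<le> C"
  shows "summable a"
proof (rule summableI_nonneg_bounded)
  fix N
  have "((\<lambda>s. \<Sum>n<N. s ^ n * a n) \<longlongrightarrow> (\<Sum>n<N. 1 ^ n * a n)) (at_left 1)"
    by (intro tendsto_intros)
  moreover have "eventually (\<lambda>s::real. s \<in> {0<..<1}) (at_left 1)"
    by (rule eventually_at_leftI[of 0]) auto
  then have "eventually (\<lambda>s. (\<Sum>n<N. s ^ n * a n) \<le> C) (at_left 1)"
    by eventually_elim (use assms(2) in auto)
  ultimately show "(\<Sum>n<N. a n) \<le> C"
    by (auto dest: tendsto_upperbound)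
qed (use assms in auto)

lemma real_vec_add: "real_vec (a + b) = real_vec a + real_vec b"
  by (simp add: real_vec_def vec_eq_iff)

locale stratified_environment =
  fixes p q r :: "int \<Rightarrow> real" and \<mu> :: "int \<Rightarrow> (int ^ 'd::finite) pmf"
  assumes pos: "0 < p n" "0 < q n" "0 < r n" and sum1: "p n + q n + r n = 1"
begin

text \<open>A \<open>pmf\<close> version of \<open>strat_trans\<close>, so that
  \<open>step_law\<close> and \<open>path_pmf\<close> apply.\<close>

definition kernel :: "(int ^ 'd) \<times> int \<Rightarrow> ((int ^ 'd) \<times> int) pmf" where
  "kernel z = bind_pmf (bernoulli_pmf (r (snd z))) (\<lambda>b.
     if b then map_pmf (\<lambda>k. (fst z + k, snd z)) (\<mu> (snd z))
     else map_pmf (\<lambda>u. (fst z, if u then snd z + 1 else snd z - 1))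
       (bernoulli_pmf (p (snd z) / (p (snd z) + q (snd z)))))"

lemma integral_kernel_real:
  fixes f :: "(int ^ 'd) \<times> int \<Rightarrow> real"
  assumes "\<And>x. \<bar>f x\<bar> \<le> B"
  shows "(\<integral>x. f x \<partial>kernel (m, n)) =
    p n * f (m, n + 1) + q n * f (m, n - 1) + r n * (\<integral>k. f (m + k, n) \<partial>\<mu> n)"
proof -
  have nz: "p n + q n \<noteq> 0" using pos(1,2)[of n] by linarith
  have *: "0 \<le> r n" "r n \<le> 1" "1 - r n = p n + q n"
    "0 \<le> p n / (p n + q n)" "p n / (p n + q n) \<le> 1" "1 - p n / (p n + q n) = q n / (p n + q n)"
    using pos[of n] sum1[of n] by (auto simp: field_simps)
  have "(\<integral>x. f x \<partial>kernel (m, n)) = (\<integral>k. f (m + k, n) \<partial>\<mu> n) * r n +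
      (f (m, n + 1) * (p n / (p n + q n)) + f (m, n - 1) * (q n / (p n + q n))) * (p n + q n)"
    unfolding kernel_def integral_bind_pmf_real[where f = f, OF assms]
    using * by simp
  also have "(f (m, n + 1) * (p n / (p n + q n)) + f (m, n - 1) * (q n / (p n + q n))) * (p n + q n) =
      f (m, n + 1) * p n + f (m, n - 1) * q n"
    using nz by (simp add: add_divide_distrib[symmetric])
  finally show ?thesis by (simp add: algebra_simps)
qed

lemma pmf_kernel: "pmf (kernel x) y = strat_trans p q r \<mu> x y"
proof -
  obtain m n where x: "x = (m, n)" by force
  obtain m' n' where y: "y = (m', n')" by force
  have "pmf (kernel x) y = (\<integral>z. indicator {y} z \<partial>kernel x)"
    by (simp add: measure_pmf_single)
  also have "\<dots> = p n * indicator {y} (m, n + 1) + q n * indicator {y} (m, n - 1)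
      + r n * (\<integral>k. indicator {y} (m + k, n) \<partial>\<mu> n)"
    unfolding x by (rule integral_kernel_real[where B = 1]) (auto simp: indicator_def)
  also have "(\<integral>k. indicator {y} (m + k, n) \<partial>\<mu> n) = (if n' = n then pmf (\<mu> n) (m' - m) else 0 :: real)"
  proof -
    have "(\<lambda>k. indicator {y} (m + k, n)) = (\<lambda>k. if n' = n then indicator {m' - m} k else 0 :: real)"
      by (auto simp: y indicator_def fun_eq_iff)
    then show ?thesis by (simp add: measure_pmf_single)
  qed
  finally show ?thesis by (auto simp: x y strat_trans_def indicator_def)
qed

lemma kernel_eq: "(\<lambda>x y. pmf (kernel x) y) = strat_trans p q r \<mu>"
  by (simp add: fun_eq_iff pmf_kernel)

section \<open>Fourier transform of the law at time \<open>n\<close>\<close>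

definition law :: "nat \<Rightarrow> ((int ^ 'd) \<times> int) pmf" where "law = step_law kernel (0, 0)"

definition char_fun :: "real ^ 'd \<Rightarrow> int \<Rightarrow> complex" where
  "char_fun v y = (\<integral>k. cis (v \<bullet> real_vec k) \<partial>\<mu> y)"

definition wave :: "real ^ 'd \<Rightarrow> int \<Rightarrow> (int ^ 'd) \<times> int \<Rightarrow> complex" where
  "wave v y z = (if snd z = y then cis (v \<bullet> real_vec (fst z)) else 0)"

definition fourier :: "real ^ 'd \<Rightarrow> nat \<Rightarrow> int \<Rightarrow> complex" where
  "fourier v n y = (\<integral>z. wave v y z \<partial>law n)"

lemma norm_wave: "norm (wave v y z) \<le> 1"
  by (simp add: wave_def)

lemma fourier_0: "fourier v 0 y = (if y = 0 then 1 else 0)"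
proof -
  have "real_vec 0 = (0 :: real ^ 'd)" by (simp add: real_vec_def vec_eq_iff)
  then show ?thesis by (simp add: fourier_def law_def wave_def)
qed

text \<open>The transition laws depend only on the level, so a plane wave on one level is an
  eigenfunction of the horizontal steps with eigenvalue \<open>char_fun v y\<close>. For fixed
  \<open>v\<close> a recursion in the level alone remains.\<close>

lemma integral_kernel_wave:
  "(\<integral>z'. wave v y z' \<partial>kernel z) =
     of_real (p (y - 1)) * wave v (y - 1) z + of_real (q (y + 1)) * wave v (y + 1) z + of_real (r y) * char_fun v y * wave v y z"
proof -
  obtain m n where z: "z = (m, n)" by force
  define f where "f = wave v y"
  have b: "norm (f x) \<le> 1" "\<bar>Re (f x)\<bar> \<le> 1" "\<bar>Im (f x)\<bar> \<le> 1" for x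
    using norm_wave[of v y x] abs_Re_le_cmod[of "f x"] abs_Im_le_cmod[of "f x"]
    unfolding f_def by linarith+
  have "(\<integral>x. f x \<partial>kernel (m, n)) =
    of_real (p n) * f (m, n + 1) + of_real (q n) * f (m, n - 1) + of_real (r n) * (\<integral>k. f (m + k, n) \<partial>\<mu> n)"
    by (rule complex_eqI)
       (simp_all add: integral_complex_parts[OF b(1)] integral_kernel_real[where B = 1] b(2,3))
  also have "(\<integral>k. f (m + k, n) \<partial>\<mu> n) = char_fun v y * wave v y z"
  proof (cases "n = y")
    case True
    have "(\<integral>k. f (m + k, n) \<partial>\<mu> n) = (\<integral>k. cis (v \<bullet> real_vec k) * cis (v \<bullet> real_vec m) \<partial>\<mu> n)"
      using True by (simp add: f_def wave_def real_vec_add inner_add_right cis_mult add.commute)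
    also have "\<dots> = char_fun v y * cis (v \<bullet> real_vec m)"
      unfolding char_fun_def True
      by (rule integral_mult_left_zero)
    finally show ?thesis using True by (simp add: wave_def z)
  qed (simp add: f_def wave_def z)
  finally show ?thesis by (auto simp: f_def wave_def z)
qed

lemma fourier_Suc:
  "fourier v (Suc n) y = of_real (p (y - 1)) * fourier v n (y - 1) + of_real (q (y + 1)) * fourier v n (y + 1)
     + of_real (r y) * char_fun v y * fourier v n y"
proof -
  define f where "f = wave v y"
  have b: "norm (f x) \<le> 1" "\<bar>Re (f x)\<bar> \<le> 1" "\<bar>Im (f x)\<bar> \<le> 1" for x
    using norm_wave[of v y x] abs_Re_le_cmod[of "f x"] abs_Im_le_cmod[of "f x"]
    unfolding f_def by linarith+
  have bK: "norm (\<integral>z'. f z' \<partial>kernel z) \<le> 1" for z by (rule norm_integral_pmf_le) (rule b)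
  have [simp]: "integrable (measure_pmf M) (wave v y)" for M y
    by (rule integrable_pmf_bounded) (rule norm_wave)
  have "fourier v (Suc n) y = (\<integral>x. f x \<partial>bind_pmf (law n) kernel)"
    by (simp add: fourier_def law_def f_def)
  also have "\<dots> = (\<integral>z. (\<integral>z'. f z' \<partial>kernel z) \<partial>law n)"
    by (rule complex_eqI)
       (simp_all add: integral_complex_parts[OF b(1)] integral_complex_parts[OF bK]
         integral_bind_pmf_real[where B = 1] b(2,3))
  also have "\<dots> = of_real (p (y - 1)) * fourier v n (y - 1) + of_real (q (y + 1)) * fourier v n (y + 1)
     + of_real (r y) * char_fun v y * fourier v n y"
    unfolding f_def integral_kernel_wave fourier_def by simp
  finally show ?thesis .
qed

lemma norm_fourier: "norm (fourier v n y) \<le> 1"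
  unfolding fourier_def by (rule norm_integral_pmf_le) (rule norm_wave)

lemma fourier_eq_0: "int n < \<bar>y\<bar> \<Longrightarrow> fourier v n y = 0"
  by (induction n arbitrary: y) (auto simp: fourier_0 fourier_Suc)

section \<open>Green function with Abel weights\<close>

definition green :: "real \<Rightarrow> real ^ 'd \<Rightarrow> int \<Rightarrow> complex" where
  "green s v y = (\<Sum>n. of_real s ^ n * fourier v n y)"

context
  fixes s :: real
  assumes s: "0 < s" "s < 1"
begin

lemma summable_green: "summable (\<lambda>n. of_real s ^ n * fourier v n y)"
  by (rule summable_comparison_test[OF _ summable_geometric[of s]])
     (use s norm_fourier in \<open>auto intro!: exI[of _ 0] mult_left_le simp: norm_mult norm_power\<close>)

lemma green_eq:
  "green s v y = (if y = 0 then 1 else 0) + of_real s * (of_real (p (y - 1)) * green s v (y - 1)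
     + of_real (q (y + 1)) * green s v (y + 1) + of_real (r y) * char_fun v y * green s v y)"
proof -
  let ?h = "\<lambda>y n. of_real s ^ n * fourier v n y"
  have h: "?h y sums green s v y" for y
    unfolding green_def by (rule summable_sums[OF summable_green])
  have "(\<lambda>n. of_real s * (of_real (p (y - 1)) * ?h (y - 1) n + of_real (q (y + 1)) * ?h (y + 1) n
      + of_real (r y) * char_fun v y * ?h y n))
    sums (of_real s * (of_real (p (y - 1)) * green s v (y - 1) + of_real (q (y + 1)) * green s v (y + 1)
      + of_real (r y) * char_fun v y * green s v y))"
    by (intro sums_add sums_mult h)
  also have "(\<lambda>n. of_real s * (of_real (p (y - 1)) * ?h (y - 1) n + of_real (q (y + 1)) * ?h (y + 1) n
      + of_real (r y) * char_fun v y * ?h y n)) = (\<lambda>n. ?h y (Suc n))"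
    by (rule ext) (simp only: fourier_Suc power_Suc ring_distribs mult_ac)
  finally have "?h y sums (of_real s * (of_real (p (y - 1)) * green s v (y - 1)
      + of_real (q (y + 1)) * green s v (y + 1) + of_real (r y) * char_fun v y * green s v y) + ?h y 0)"
    by (rule sums_Suc)
  from sums_unique2[OF h this] show ?thesis by (simp add: fourier_0 add.commute)
qed

text \<open>Level \<open>y\<close> cannot be reached before time \<open>\<bar>y\<bar>\<close>, so
  the series starts there. This gives the decay at both ends that \<open>killed_flow\<close>
  demands.\<close>

lemma norm_green: "norm (green s v y) \<le> s ^ nat \<bar>y\<bar> / (1 - s)"
proof -
  let ?k = "nat \<bar>y\<bar>"
  have "green s v y = (\<Sum>n. of_real s ^ (n + ?k) * fourier v (n + ?k) y)"
    unfolding green_def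
    by (subst suminf_split_initial_segment[OF summable_green, of _ _ ?k]) (simp add: fourier_eq_0)
  also have "norm \<dots> \<le> (\<Sum>n. s ^ ?k * s ^ n)"
  proof (rule norm_suminf_le)
    show "norm (of_real s ^ (n + ?k) * fourier v (n + ?k) y) \<le> s ^ ?k * s ^ n" for n
      using s norm_fourier[of v "n + ?k" y]
      by (simp add: norm_mult norm_power power_add mult_left_le mult.commute)
  qed (use s in \<open>auto intro!: summable_mult summable_geometric\<close>)
  also have "\<dots> = s ^ ?k / (1 - s)"
    using s by (simp add: suminf_mult suminf_geometric)
  finally show ?thesis .
qed

text \<open>The diagonal term of \<open>green_eq\<close> is moved to the left and moduli are taken.
  The rate \<open>w\<close> is the surplus of the diagonal coefficient over
  \<open>p y + q y\<close>.\<close>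

lemma killed_flow_green:
  assumes w: "0 \<le> w" and chi: "\<And>y. p y + q y + w \<le> norm (1 - of_real s * of_real (r y) * char_fun v y)"
  shows "killed_flow p q (\<lambda>y. norm (green s v y)) w"
proof
  fix y
  show "p y \<le> 1" "q y \<le> 1" using pos[of y] sum1[of y] by linarith+
  have "(1 - of_real s * of_real (r y) * char_fun v y) * green s v y =
      (if y = 0 then 1 else 0) + of_real s * (of_real (p (y - 1)) * green s v (y - 1) + of_real (q (y + 1)) * green s v (y + 1))"
    using green_eq[of v y] by (simp add: algebra_simps)
  then have "norm (1 - of_real s * of_real (r y) * char_fun v y) * norm (green s v y) \<le>
      norm (if y = 0 then 1 else 0 :: complex)
      + norm (of_real s * (of_real (p (y - 1)) * green s v (y - 1) + of_real (q (y + 1)) * green s v (y + 1)))"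
    unfolding norm_mult[symmetric] by (metis norm_triangle_ineq)
  also have "norm (of_real s * (of_real (p (y - 1)) * green s v (y - 1) + of_real (q (y + 1)) * green s v (y + 1)))
      \<le> norm (of_real (p (y - 1)) * green s v (y - 1) + of_real (q (y + 1)) * green s v (y + 1))"
    using s by (simp add: norm_mult mult_left_le_one_le)
  also have "\<dots> \<le> p (y - 1) * norm (green s v (y - 1)) + q (y + 1) * norm (green s v (y + 1))"
    by (rule order_trans[OF norm_triangle_ineq]) (use pos in \<open>simp add: norm_mult less_imp_le\<close>)
  also have "(p y + q y + w) * norm (green s v y) \<le> norm (1 - of_real s * of_real (r y) * char_fun v y) * norm (green s v y)"
    by (rule mult_right_mono[OF chi]) simp
  finally show "(p y + q y + w) * norm (green s v y) \<le> (if y = 0 then 1 else 0)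
      + p (y - 1) * norm (green s v (y - 1)) + q (y + 1) * norm (green s v (y + 1))"
    by (simp split: if_splits)
next
  have lim: "(\<lambda>n. s ^ n / (1 - s)) \<longlonglongrightarrow> 0"
    using s by (auto intro!: tendsto_divide_zero LIMSEQ_power_zero)
  show "(\<lambda>n. norm (green s v (int n))) \<longlonglongrightarrow> 0"
    by (rule tendsto_sandwich[OF _ _ tendsto_const lim]) (use norm_green[of v "int _"] in auto)
  show "(\<lambda>n. norm (green s v (- int n))) \<longlonglongrightarrow> 0"
    by (rule tendsto_sandwich[OF _ _ tendsto_const lim]) (use norm_green[of v "- int _"] in auto)
qed (use w pos in auto)

lemma norm_one_minus_ge:
  assumes "0 \<le> c" "c \<le> 1" "Re (char_fun v y) \<le> 1 - c"
  shows "p y + q y + r y * c \<le> norm (1 - of_real s * of_real (r y) * char_fun v y)"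
proof -
  have "s * (r y * Re (char_fun v y)) \<le> r y * (1 - c)"
  \<comment> \<open>Multiplying by \<open>s < 1\<close> does not increase the real part when it is
    nonnegative; a negative one is compared with \<open>0\<close> instead.\<close>
  proof (cases "0 \<le> Re (char_fun v y)")
    case True
    then have "s * (r y * Re (char_fun v y)) \<le> r y * Re (char_fun v y)"
      using s pos(3)[of y] by (intro mult_left_le_one_le) auto
    also have "\<dots> \<le> r y * (1 - c)" using assms(3) pos(3)[of y] by simp
    finally show ?thesis .
  next
    case False
    then have "s * (r y * Re (char_fun v y)) \<le> 0"
      using s pos(3)[of y] by (simp add: mult_le_0_iff zero_le_mult_iff)
    also have "0 \<le> r y * (1 - c)" using assms pos(3)[of y] by simp
    finally show ?thesis .
  qed
  moreover have "1 - s * (r y * Re (char_fun v y)) \<le> norm (1 - of_real s * of_real (r y) * char_fun v y)"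
    using complex_Re_le_cmod[of "1 - of_real s * of_real (r y) * char_fun v y"] by simp
  ultimately show ?thesis using sum1[of y] by (simp add: algebra_simps)
qed

lemma killed_flow_green_0: "killed_flow p q (\<lambda>y. norm (green s v y)) 0"
proof (rule killed_flow_green)
  fix y
  have "norm (char_fun v y) \<le> 1" unfolding char_fun_def by (rule norm_integral_pmf_le) simp
  then have "Re (char_fun v y) \<le> 1 - 0" using complex_Re_le_cmod[of "char_fun v y"] by linarith
  from norm_one_minus_ge[OF _ _ this] show "p y + q y + 0 \<le> norm (1 - of_real s * of_real (r y) * char_fun v y)" by simp
qed simp

end

text \<open>At frequency \<open>0\<close> the transform forgets the horizontal coordinate and
  becomes the probability of being on level \<open>0\<close>.\<close>

lemma return_le_fourier: "pmf (law n) (0, 0) \<le> Re (fourier 0 n 0)"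
proof -
  have "pmf (law n) (0, 0) = measure (law n) {(0, 0)}" by (simp add: measure_pmf_single)
  also have "\<dots> \<le> measure (law n) {z. snd z = 0}"
    by (rule measure_pmf.finite_measure_mono) auto
  also have "\<dots> = (\<integral>z. indicator {z. snd z = 0} z \<partial>law n)" by simp
  also have "\<dots> = Re (fourier 0 n 0)"
    unfolding fourier_def integral_complex_parts(1)[OF norm_wave]
    by (intro Bochner_Integration.integral_cong refl) (auto simp: wave_def indicator_def)
  finally show ?thesis .
qed

lemma Re_green: "0 < s \<Longrightarrow> s < 1 \<Longrightarrow> (\<lambda>n. s ^ n * Re (fourier v n y)) sums Re (green s v y)"
  using sums_Re[OF summable_sums[OF summable_green], of s v y]
  by (simp add: green_def Re_power_real flip: of_real_power)

lemma summable_return_if_green_bounded: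
  assumes "\<And>s. 0 < s \<Longrightarrow> s < 1 \<Longrightarrow> norm (green s 0 0) \<le> C"
  shows "summable (\<lambda>n. pmf (law n) (0, 0))"
proof (rule summable_of_Abel_bound)
  fix s :: real and N assume s: "0 < s" "s < 1"
  have nn: "0 \<le> s ^ n * Re (fourier 0 n 0)" for n
    using s return_le_fourier[of n] pmf_nonneg[of "law n" "(0, 0)"]
    by (intro mult_nonneg_nonneg) (auto simp del: pmf_nonneg)
  have "(\<Sum>n<N. s ^ n * pmf (law n) (0, 0)) \<le> (\<Sum>n<N. s ^ n * Re (fourier 0 n 0))"
    using s return_le_fourier by (intro sum_mono mult_left_mono) auto
  also have "\<dots> \<le> Re (green s 0 0)"
    using sum_le_suminf[OF sums_summable[OF Re_green[OF s]], of "{..<N}" 0 0] nn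
      sums_unique[OF Re_green[OF s]] by auto
  also have "\<dots> \<le> C" using assms[OF s] complex_Re_le_cmod[of "green s 0 0"] by linarith
  finally show "(\<Sum>n<N. s ^ n * pmf (law n) (0, 0)) \<le> C" .
qed simp

section \<open>Transience when one side has finite total resistance\<close>

lemma transient_if_summable_return:
  assumes "summable (\<lambda>n. pmf (law n) (0, 0))" "markov_chain N S (strat_trans p q r \<mu>) (0, 0)"
  shows "transient_at N S (0, 0)"
  using transient_if_summable[of N S kernel "(0, 0)"] assms by (simp add: kernel_eq law_def)

text \<open>At frequency \<open>0\<close> no killing is available, but the total resistance bounds
  the Green function uniformly in \<open>s\<close>.\<close>

theorem transient_if_right_resistance:
  assumes "summable (resistance p q)" "markov_chain N S (strat_trans p q r \<mu>) (0, 0)"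
  shows "transient_at N S (0, 0)"
proof (rule transient_if_summable_return[OF summable_return_if_green_bounded assms(2)])
  fix s :: real assume s: "0 < s" "s < 1"
  interpret killed_flow p q "\<lambda>y. norm (green s 0 y)" 0 by (rule killed_flow_green_0[OF s])
  show "norm (green s 0 0) \<le> (\<Sum>n. resistance p q n) / p 0"
    using green_le_total_resistance[OF assms(1)] pos(1)[of 0] by (simp add: field_simps)
qed

theorem transient_if_left_resistance:
  assumes "summable (resistance (\<lambda>y. q (- y)) (\<lambda>y. p (- y)))"
    "markov_chain N S (strat_trans p q r \<mu>) (0, 0)"
  shows "transient_at N S (0, 0)"
proof (rule transient_if_summable_return[OF summable_return_if_green_bounded assms(2)])
  fix s :: real assume s: "0 < s" "s < 1"
  interpret K: killed_flow p q "\<lambda>y. norm (green s 0 y)" 0 by (rule killed_flow_green_0[OF s])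
  \<comment> \<open>Reflection at \<open>0\<close> exchanges the roles of \<open>p\<close> and
    \<open>q\<close>.\<close>
  interpret killed_flow "\<lambda>y. q (- y)" "\<lambda>y. p (- y)" "\<lambda>y. norm (green s 0 (- y))" 0
  proof
    fix y :: int
    have e: "- (y - 1) = - y + 1" "- (y + 1) = - y - 1" by simp_all
    show "(q (- y) + p (- y) + 0) * norm (green s 0 (- y)) \<le> (if y = 0 then 1 else 0)
      + q (- (y - 1)) * norm (green s 0 (- (y - 1))) + p (- (y + 1)) * norm (green s 0 (- (y + 1)))"
      unfolding e using K.ineq[of "- y"] by (simp add: add.commute add.left_commute)
  qed (use K.p K.q K.lim1 K.lim2 in auto)
  show "norm (green s 0 0) \<le> (\<Sum>n. resistance (\<lambda>y. q (- y)) (\<lambda>y. p (- y)) n) / q 0"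
    using green_le_total_resistance[OF assms(1)] pos(2)[of 0] by (simp add: field_simps)
qed

end

section \<open>Characteristic functions near the origin\<close>

text \<open>By compactness the Rayleigh quotient attains its minimum, and it does so at an
  eigenvector, so the minimum lies in the spectrum.\<close>

lemma symmetric_form_ge:
  fixes A :: "real ^ 'n ^ 'n::finite"
  assumes sym: "transpose A = A" and spec: "matrix_spectrum A \<subseteq> {\<eta>..}"
  shows "\<eta> * (v \<bullet> v) \<le> v \<bullet> (A *v v)"
proof -
  define f where "f = (\<lambda>v. v \<bullet> (A *v v))"
  have "continuous_on (sphere 0 1) f"
    unfolding f_def by (intro continuous_intros matrix_vector_mult_linear_continuous_on)
  moreover have "sphere 0 1 \<noteq> ({} :: (real ^ 'n) set)" by simp
  ultimately obtain u where u: "u \<in> sphere 0 1" "\<And>x. x \<in> sphere 0 1 \<Longrightarrow> f u \<le> f x"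
    using continuous_attains_inf[of "sphere 0 1" f] by auto
  have uu: "u \<bullet> u = 1" using u(1) by (simp add: dot_square_norm)
  have swap: "x \<bullet> (A *v y) = y \<bullet> (A *v x)" for x y
    by (metis sym dot_lmul_matrix inner_commute vector_transpose_matrix)
  have min: "f u * (x \<bullet> x) \<le> f x" for x
  proof (cases "x = 0")
    case False
    then have n: "norm x \<noteq> 0" by simp
    have "f u \<le> f ((1 / norm x) *\<^sub>R x)" by (rule u(2)) (use n in auto)
    also have "\<dots> = f x / (norm x)\<^sup>2"
      by (simp add: f_def matrix_vector_mult_scaleR power2_eq_square)
    finally show ?thesis using n by (simp add: dot_square_norm field_simps)
  qed (simp add: f_def)
  \<comment> \<open>The residual of the eigenvalue equation at the minimiser \<open>u\<close>.
    Comparing \<open>u\<close> with \<open>u - t *\<^sub>R b\<close> for small \<open>t > 0\<close>,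
    the first-order term \<open>- 2 * t * (b \<bullet> b)\<close> cannot be negative, so
    \<open>b = 0\<close>.\<close>
  define b where "b = A *v u - f u *\<^sub>R u"
  have bb: "2 * (b \<bullet> b) \<le> t * (f b - f u * (b \<bullet> b))" if "0 < t" for t
  proof -
    have "0 \<le> f (u - t *\<^sub>R b) - f u * ((u - t *\<^sub>R b) \<bullet> (u - t *\<^sub>R b))" using min by simp
    also have "\<dots> = f u - f u * (u \<bullet> u) - 2 * t * (b \<bullet> (A *v u) - f u * (b \<bullet> u))
        + t * t * (f b - f u * (b \<bullet> b))"
      using swap[of u b]
      by (simp add: f_def matrix_vector_mult_diff_distrib matrix_vector_mult_scaleR inner_diff_left
          inner_diff_right inner_commute algebra_simps)
    also have "b \<bullet> (A *v u) - f u * (b \<bullet> u) = b \<bullet> b"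
      by (subst (3) b_def) (simp add: inner_diff_right)
    finally have "t * (2 * (b \<bullet> b)) \<le> t * (t * (f b - f u * (b \<bullet> b)))"
      using uu by (simp add: algebra_simps)
    then show ?thesis using that by simp
  qed
  have "((\<lambda>t. t * (f b - f u * (b \<bullet> b))) \<longlongrightarrow> 0 * (f b - f u * (b \<bullet> b))) (at_right 0)"
    by (intro tendsto_intros)
  moreover have "eventually (\<lambda>t. 2 * (b \<bullet> b) \<le> t * (f b - f u * (b \<bullet> b))) (at_right 0)"
    by (rule eventually_at_rightI[of 0 1]) (use bb in auto)
  ultimately have "2 * (b \<bullet> b) \<le> 0 * (f b - f u * (b \<bullet> b))"
    by (intro tendsto_lowerbound[where F = "at_right 0"]) auto
  then have "b \<bullet> b = 0" using inner_ge_zero[of b] by linarith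
  then have "b = 0" by simp
  then have "A *v u = f u *s u" by (simp add: b_def scalar_mult_eq_scaleR)
  moreover have "u \<noteq> 0" using uu by auto
  ultimately have "\<eta> \<le> f u" using spec by (auto simp: matrix_spectrum_def)
  then have "\<eta> * (v \<bullet> v) \<le> f u * (v \<bullet> v)" by (intro mult_right_mono) auto
  also have "\<dots> \<le> v \<bullet> (A *v v)" using min[of v] by (simp add: f_def)
  finally show ?thesis .
qed

section \<open>Moments and the quadratic decrease of the characteristic function\<close>

lemma
  fixes f :: "'a \<Rightarrow> real"
  assumes "(\<lambda>k. \<bar>f k\<bar> * pmf \<nu> k) summable_on UNIV"
  shows integrable_pmf_infsum: "integrable (measure_pmf \<nu>) f"
    and integral_pmf_infsum: "(\<integral>k. f k \<partial>\<nu>) = (\<Sum>\<^sub>\<infinity>k\<in>UNIV. f k * pmf \<nu> k)"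
proof -
  have "(\<lambda>k. norm (pmf \<nu> k * f k)) summable_on UNIV"
    using assms by (simp add: abs_mult mult.commute[of "pmf \<nu> _"])
  then have *: "Infinite_Set_Sum.abs_summable_on (\<lambda>k. pmf \<nu> k * f k) UNIV"
    by (rule abs_summable_equivalent[THEN iffD1])
  then show "integrable (measure_pmf \<nu>) f"
    unfolding measure_pmf_eq_density abs_summable_on_def by (subst integrable_density) auto
  have "(\<integral>k. f k \<partial>\<nu>) = infsetsum (\<lambda>k. pmf \<nu> k * f k) UNIV"
    unfolding infsetsum_def measure_pmf_eq_density by (subst integral_density) simp_all
  also have "\<dots> = (\<Sum>\<^sub>\<infinity>k\<in>UNIV. pmf \<nu> k * f k)" by (rule infsetsum_infsum[OF *])
  finally show "(\<integral>k. f k \<partial>\<nu>) = (\<Sum>\<^sub>\<infinity>k\<in>UNIV. f k * pmf \<nu> k)" by (simp add: mult.commute)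
qed

lemma norm_real_vec_ge_1:
  fixes k :: "int ^ 'd::finite"
  assumes "real_vec k \<noteq> 0"
  shows "1 \<le> norm (real_vec k)"
proof -
  obtain i where "real_vec k $ i \<noteq> 0" using assms by (auto simp: vec_eq_iff)
  then have "1 \<le> \<bar>real_vec k $ i\<bar>" by (simp add: real_vec_def)
  then show ?thesis using component_le_norm_cart[of "real_vec k" i] by linarith
qed

lemma cos_le_cubic: "cos x \<le> 1 - x\<^sup>2 / 2 + \<bar>x\<bar> ^ 3 / 6" for x :: real
proof -
  obtain t where t: "cos x = (\<Sum>m<3. cos_coeff m * x ^ m) + (cos (t + 1/2 * real 3 * pi) / fact 3) * x ^ 3"
    using Maclaurin_cos_expansion[of x 3] by blast
  have "(\<Sum>m<3. cos_coeff m * x ^ m) = 1 - x\<^sup>2 / 2"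
    by (simp add: numeral_3_eq_3 cos_coeff_def power2_eq_square)
  moreover have "cos (t + 1/2 * real 3 * pi) * x ^ 3 \<le> \<bar>x\<bar> ^ 3"
  proof -
    have "cos (t + 1/2 * real 3 * pi) * x ^ 3 \<le> \<bar>cos (t + 1/2 * real 3 * pi)\<bar> * \<bar>x ^ 3\<bar>"
      by (metis abs_ge_self abs_mult)
    also have "\<dots> \<le> \<bar>x ^ 3\<bar>" by (intro mult_left_le_one_le) auto
    finally show ?thesis by (simp add: power_abs)
  qed
  ultimately show ?thesis using t by (simp add: fact_numeral)
qed

text \<open>In the Taylor expansion the spectral bound makes the quadratic loss at least
  \<open>\<eta> * (norm v)\<^sup>2 / 2\<close>; for small \<open>v\<close> the cubic error takes
  back at most half of it.\<close>

lemma Re_char_le: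
  fixes \<nu> :: "(int ^ 'd::finite) pmf"
  assumes \<eta>: "0 < \<eta>" and D: "3 \<le> D"
    and sm: "(\<lambda>k. norm (real_vec k) ^ D * pmf \<nu> k) summable_on UNIV"
    and bd: "(\<Sum>\<^sub>\<infinity>k\<in>UNIV. norm (real_vec k) ^ D * pmf \<nu> k) \<le> 1 / \<eta>"
    and spec: "matrix_spectrum (second_moment_matrix \<nu>) \<subseteq> {\<eta>..}"
    and v: "norm v \<le> 3 * \<eta>\<^sup>2 / 2"
  shows "(\<integral>k. cos (v \<bullet> real_vec k) \<partial>\<nu>) \<le> 1 - \<eta> * (norm v)\<^sup>2 / 4"
proof -
  \<comment> \<open>A nonzero lattice vector has norm at least \<open>1\<close>, so the moment of
    order \<open>D\<close> controls the lower ones.\<close>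
  have pow_le: "norm (real_vec k) ^ j \<le> norm (real_vec k) ^ D" if "0 < j" "j \<le> D" for j and k :: "int ^ 'd"
  proof (cases "real_vec k = 0")
    case False
    then show ?thesis using norm_real_vec_ge_1[of k] that by (intro power_increasing) auto
  qed (use that D in \<open>simp add: power_0_left\<close>)
  have smj: "(\<lambda>k. norm (real_vec k) ^ j * pmf \<nu> k) summable_on UNIV" if "0 < j" "j \<le> D" for j
    by (rule summable_on_comparison_test[OF sm]) (use pow_le[OF that] in \<open>auto intro: mult_right_mono\<close>)
  have intj: "integrable (measure_pmf \<nu>) (\<lambda>k. norm (real_vec k) ^ j)" if "0 < j" "j \<le> D" for j
    by (rule integrable_pmf_infsum) (use smj[OF that] in simp)
  have "(\<integral>k. norm (real_vec k) ^ 3 \<partial>\<nu>) \<le> (\<integral>k. norm (real_vec k) ^ D \<partial>\<nu>)"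
    by (intro integral_mono intj) (use D pow_le in auto)
  also have "\<dots> \<le> 1 / \<eta>"
    using bd integral_pmf_infsum[of "\<lambda>k. norm (real_vec k) ^ D" \<nu>] sm by simp
  finally have third: "(\<integral>k. norm (real_vec k) ^ 3 \<partial>\<nu>) \<le> 1 / \<eta>" .
  have comp: "\<bar>real_vec k $ i * real_vec k $ j\<bar> \<le> norm (real_vec k) ^ 2" for i j and k :: "int ^ 'd"
    unfolding abs_mult power2_eq_square by (intro mult_mono component_le_norm_cart) auto
  have smij: "(\<lambda>k. \<bar>real_vec k $ i * real_vec k $ j\<bar> * pmf \<nu> k) summable_on UNIV" for i j
    by (rule summable_on_comparison_test[OF smj[of 2]]) (use D comp in \<open>auto intro: mult_right_mono\<close>)
  have intij [simp]: "integrable (measure_pmf \<nu>) (\<lambda>k. real_vec k $ i * real_vec k $ j)" for i j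
    by (rule integrable_pmf_infsum) (rule smij)
  define Q where "Q = second_moment_matrix \<nu>"
  have Q: "Q $ i $ j = (\<integral>k. real_vec k $ i * real_vec k $ j \<partial>\<nu>)" for i j
    using integral_pmf_infsum[OF smij] by (simp add: Q_def second_moment_matrix_def)
  have sq: "(v \<bullet> real_vec k)\<^sup>2 = (\<Sum>i\<in>UNIV. \<Sum>j\<in>UNIV. v $ i * v $ j * (real_vec k $ i * real_vec k $ j))"
    for k :: "int ^ 'd"
    by (simp add: inner_vec_def power2_eq_square sum_product mult_ac)
  have int2: "integrable (measure_pmf \<nu>) (\<lambda>k. (v \<bullet> real_vec k)\<^sup>2)"
    unfolding sq by simp
  have "(\<integral>k. (v \<bullet> real_vec k)\<^sup>2 \<partial>\<nu>) = (\<Sum>i\<in>UNIV. \<Sum>j\<in>UNIV. v $ i * v $ j * Q $ i $ j)"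
    unfolding sq by (simp add: Q)
  also have "\<dots> = v \<bullet> (Q *v v)"
    by (simp add: inner_vec_def matrix_vector_mult_def sum_distrib_left mult_ac)
  also have "\<eta> * (v \<bullet> v) \<le> v \<bullet> (Q *v v)"
  proof (rule symmetric_form_ge)
    show "transpose Q = Q" by (simp add: transpose_def vec_eq_iff Q mult.commute)
  qed (use spec in \<open>simp add: Q_def\<close>)
  finally have second: "\<eta> * (norm v)\<^sup>2 \<le> (\<integral>k. (v \<bullet> real_vec k)\<^sup>2 \<partial>\<nu>)"
    by (simp add: dot_square_norm)
  have "(\<integral>k. cos (v \<bullet> real_vec k) \<partial>\<nu>)
      \<le> (\<integral>k. 1 - (v \<bullet> real_vec k)\<^sup>2 / 2 + norm v ^ 3 / 6 * norm (real_vec k) ^ 3 \<partial>\<nu>)"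
  proof (rule integral_mono)
    show "integrable (measure_pmf \<nu>) (\<lambda>k. cos (v \<bullet> real_vec k))"
      by (rule integrable_pmf_bounded[where B = 1]) simp
    show "integrable (measure_pmf \<nu>) (\<lambda>k. 1 - (v \<bullet> real_vec k)\<^sup>2 / 2 + norm v ^ 3 / 6 * norm (real_vec k) ^ 3)"
      using int2 intj[of 3] D by simp
    fix k :: "int ^ 'd"
    have "\<bar>v \<bullet> real_vec k\<bar> ^ 3 \<le> (norm v * norm (real_vec k)) ^ 3"
      by (intro power_mono Cauchy_Schwarz_ineq2) simp
    then show "cos (v \<bullet> real_vec k) \<le> 1 - (v \<bullet> real_vec k)\<^sup>2 / 2 + norm v ^ 3 / 6 * norm (real_vec k) ^ 3"
      using cos_le_cubic[of "v \<bullet> real_vec k"] by (simp add: power_mult_distrib)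
  qed
  also have "\<dots> = 1 - (\<integral>k. (v \<bullet> real_vec k)\<^sup>2 \<partial>\<nu>) / 2 + norm v ^ 3 / 6 * (\<integral>k. norm (real_vec k) ^ 3 \<partial>\<nu>)"
    using int2 intj[of 3] D by simp
  also have "\<dots> \<le> 1 - \<eta> * (norm v)\<^sup>2 / 2 + norm v ^ 3 / 6 * (1 / \<eta>)"
    by (intro add_mono diff_mono mult_left_mono third) (use second in auto)
  \<comment> \<open>The hypothesis on \<open>norm v\<close> says exactly that
    \<open>norm v / (6 * \<eta>) \<le> \<eta> / 4\<close>.\<close>
  also have "norm v ^ 3 / 6 * (1 / \<eta>) \<le> \<eta> * (norm v)\<^sup>2 / 4"
  proof -
    have "norm v ^ 3 = norm v * (norm v)\<^sup>2" by (simp add: power2_eq_square power3_eq_cube)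
    also have "\<dots> \<le> 3 * \<eta>\<^sup>2 / 2 * (norm v)\<^sup>2" by (intro mult_right_mono v) simp
    finally show ?thesis using \<eta> by (simp add: field_simps power2_eq_square)
  qed
  finally show ?thesis by simp
qed

section \<open>Summing over a grid of frequencies\<close>

definition grid :: "nat \<Rightarrow> (nat \<times> nat) set" where "grid M = {..<2 ^ M} \<times> {..<2 ^ M}"

definition grid_dist :: "nat \<times> nat \<Rightarrow> nat \<times> nat \<Rightarrow> nat" where
  "grid_dist a b = nat (max \<bar>int (fst a) - int (fst b)\<bar> \<bar>int (snd a) - int (snd b)\<bar>)"

lemma finite_grid [simp]: "finite (grid M)"
  by (simp add: grid_def)

lemma card_grid: "card (grid M) = 4 ^ M"
proof -
  have "(4 :: nat) ^ M = (2 * 2) ^ M" by simp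
  also have "\<dots> = 2 ^ M * 2 ^ M" by (rule power_mult_distrib)
  finally show ?thesis by (simp add: grid_def)
qed

lemma grid_dist_ge_1: "a \<noteq> b \<Longrightarrow> 1 \<le> grid_dist a b"
  by (cases a; cases b) (auto simp: grid_dist_def)

lemma grid_dist_less: "a \<in> grid M \<Longrightarrow> b \<in> grid M \<Longrightarrow> grid_dist a b < 2 ^ M"
proof -
  have *: "\<bar>int x - int y\<bar> < 2 ^ M" if "x < 2 ^ M" "y < 2 ^ M" for x y
  proof -
    have "int x < 2 ^ M" "int y < 2 ^ M" using that by simp_all
    then show ?thesis by linarith
  qed
  assume "a \<in> grid M" "b \<in> grid M"
  then show ?thesis by (auto simp: grid_dist_def grid_def nat_less_iff intro!: *)
qed

lemma card_grid_ball: "card {b \<in> grid M. grid_dist a b < r} \<le> (2 * r)\<^sup>2"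
proof -
  have "{b \<in> grid M. grid_dist a b < r} \<subseteq> {fst a - r..<fst a + r} \<times> {snd a - r..<snd a + r}"
    by (auto simp: grid_dist_def)
  then have "card {b \<in> grid M. grid_dist a b < r} \<le> card ({fst a - r..<fst a + r} \<times> {snd a - r..<snd a + r})"
    by (intro card_mono) auto
  also have "\<dots> \<le> (2 * r) * (2 * r)"
    unfolding card_cartesian_product by (intro mult_mono) auto
  finally show ?thesis by (simp add: power2_eq_square)
qed

context
  fixes i1 i2 :: "'d::finite" and \<epsilon> :: real and M :: nat
  assumes i12: "i1 \<noteq> i2" and \<epsilon>: "0 < \<epsilon>"
begin

text \<open>Only two coordinate directions carry the grid: two dimensions already make differences
  at scale \<open>2\<^sup>-\<^sup>m\<close> a proportion of order
  \<open>4\<^sup>-\<^sup>m\<close>.\<close>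

definition grid_point :: "nat \<times> nat \<Rightarrow> real ^ 'd" where
  "grid_point a = axis i1 (\<epsilon> * real (fst a) / 2 ^ M) + axis i2 (\<epsilon> * real (snd a) / 2 ^ M)"

lemma grid_point_diff:
  "(grid_point a - grid_point b) $ i1 = \<epsilon> / 2 ^ M * (real (fst a) - real (fst b))"
  "(grid_point a - grid_point b) $ i2 = \<epsilon> / 2 ^ M * (real (snd a) - real (snd b))"
  using i12 by (auto simp: grid_point_def axis_def field_simps)

lemma norm_grid_diff_ge: "\<epsilon> / 2 ^ M * real (grid_dist a b) \<le> norm (grid_point a - grid_point b)"
proof -
  have "real (grid_dist a b) = max \<bar>real (fst a) - real (fst b)\<bar> \<bar>real (snd a) - real (snd b)\<bar>"
    unfolding grid_dist_def by (auto simp: max_def)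
  moreover have "\<epsilon> / 2 ^ M * \<bar>real (fst a) - real (fst b)\<bar> \<le> norm (grid_point a - grid_point b)"
    using component_le_norm_cart[of "grid_point a - grid_point b" i1] \<epsilon>
    unfolding grid_point_diff abs_mult by simp
  moreover have "\<epsilon> / 2 ^ M * \<bar>real (snd a) - real (snd b)\<bar> \<le> norm (grid_point a - grid_point b)"
    using component_le_norm_cart[of "grid_point a - grid_point b" i2] \<epsilon>
    unfolding grid_point_diff abs_mult by simp
  ultimately show ?thesis by (simp add: max_def)
qed

lemma norm_grid_diff_le:
  assumes "a \<in> grid M" "b \<in> grid M"
  shows "norm (grid_point a - grid_point b) \<le> 2 * \<epsilon>"
proof -
  have *: "\<bar>\<epsilon> / 2 ^ M * (real x - real y)\<bar> \<le> \<epsilon>" if "x < 2 ^ M" "y < 2 ^ M" for x y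
  proof -
    have "real x < 2 ^ M" "real y < 2 ^ M" using that by simp_all
    then have "\<bar>real x - real y\<bar> \<le> 2 ^ M" by linarith
    then have "\<epsilon> / 2 ^ M * \<bar>real x - real y\<bar> \<le> \<epsilon> / 2 ^ M * 2 ^ M"
      using \<epsilon> by (intro mult_left_mono) auto
    then show ?thesis using \<epsilon> by (simp add: abs_mult)
  qed
  have ax: "norm (axis i x :: real ^ 'd) = \<bar>x\<bar>" for i x
  proof -
    have "axis i x = x *\<^sub>R (axis i 1 :: real ^ 'd)" by (simp add: axis_def vec_eq_iff)
    then show ?thesis by simp
  qed
  have "grid_point a - grid_point b = axis i1 (\<epsilon> / 2 ^ M * (real (fst a) - real (fst b)))
      + axis i2 (\<epsilon> / 2 ^ M * (real (snd a) - real (snd b)))"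
    by (auto simp: grid_point_def axis_def vec_eq_iff field_simps)
  also have "norm \<dots> \<le> \<bar>\<epsilon> / 2 ^ M * (real (fst a) - real (fst b))\<bar> + \<bar>\<epsilon> / 2 ^ M * (real (snd a) - real (snd b))\<bar>"
    by (rule order_trans[OF norm_triangle_ineq]) (simp add: ax)
  also have "\<dots> \<le> \<epsilon> + \<epsilon>" by (intro add_mono *) (use assms in \<open>auto simp: grid_def\<close>)
  finally show ?thesis by simp
qed

text \<open>Dyadic decomposition by the distance to \<open>a\<close>: at most
  \<open>16 * 4 ^ j\<close> points lie at distance about \<open>2 ^ j\<close>, and each contributes
  at most \<open>4 ^ (M - j) * B (M - j)\<close>. The product depends on \<open>j\<close> only
  through \<open>B\<close>.\<close>

lemma grid_off_diagonal:
  fixes h :: "real ^ 'd \<Rightarrow> real" and B :: "nat \<Rightarrow> real"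
  assumes B: "summable B" "\<And>m. 0 \<le> B m"
    and h: "\<And>m v. \<epsilon> / 2 ^ m \<le> norm v \<Longrightarrow> norm v \<le> 2 * \<epsilon> \<Longrightarrow> h v \<le> 4 ^ m * B m"
    and h0: "\<And>v. 0 \<le> h v"
    and a: "a \<in> grid M"
  shows "(\<Sum>b\<in>grid M - {a}. h (grid_point a - grid_point b)) \<le> 16 * 4 ^ M * suminf B"
proof -
  define A where "A j = {b \<in> grid M. 2 ^ j \<le> grid_dist a b \<and> grid_dist a b < 2 ^ (j + 1)}" for j
  have fin [simp]: "finite (A j)" for j by (simp add: A_def)
  have sub: "grid M - {a} \<subseteq> (\<Union>j\<in>{..<M}. A j)"
  proof
    fix b assume b: "b \<in> grid M - {a}"
    then have "1 \<le> grid_dist a b" by (intro grid_dist_ge_1) auto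
    then obtain j where j: "2 ^ j \<le> grid_dist a b" "grid_dist a b < 2 ^ (j + 1)"
      using ex_power_ivl1[of 2 "grid_dist a b"] by auto
    have "grid_dist a b < 2 ^ M" using a b by (intro grid_dist_less) auto
    with j have "(2::nat) ^ j < 2 ^ M" by linarith
    then have "j < M" by simp
    with j b show "b \<in> (\<Union>j\<in>{..<M}. A j)" by (auto simp: A_def)
  qed
  have Aj: "(\<Sum>b\<in>A j. h (grid_point a - grid_point b)) \<le> 16 * 4 ^ M * B (M - j)" if "j < M" for j
  proof -
    have "(\<Sum>b\<in>A j. h (grid_point a - grid_point b)) \<le> real (card (A j)) * (4 ^ (M - j) * B (M - j))"
    proof (rule sum_bounded_above)
      fix b assume b: "b \<in> A j"
      show "h (grid_point a - grid_point b) \<le> 4 ^ (M - j) * B (M - j)"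
      proof (rule h)
        have "\<epsilon> / 2 ^ (M - j) = \<epsilon> / 2 ^ M * 2 ^ j"
          using that by (simp add: power_diff)
        also have "\<dots> \<le> \<epsilon> / 2 ^ M * real (grid_dist a b)"
        proof (intro mult_left_mono)
          have "real (2 ^ j) \<le> real (grid_dist a b)" using b by (simp only: of_nat_le_iff A_def) simp
          then show "2 ^ j \<le> real (grid_dist a b)" by simp
        qed (use \<epsilon> in simp)
        also have "\<dots> \<le> norm (grid_point a - grid_point b)" by (rule norm_grid_diff_ge)
        finally show "\<epsilon> / 2 ^ (M - j) \<le> norm (grid_point a - grid_point b)" .
      qed (use b a norm_grid_diff_le in \<open>auto simp: A_def\<close>)
    qed
    also have "\<dots> \<le> 16 * 4 ^ j * (4 ^ (M - j) * B (M - j))"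
    proof (intro mult_right_mono)
      have "card (A j) \<le> card {b \<in> grid M. grid_dist a b < 2 ^ (j + 1)}"
        by (rule card_mono) (auto simp: A_def)
      also have "\<dots> \<le> (2 * 2 ^ (j + 1))\<^sup>2" by (rule card_grid_ball)
      also have "\<dots> = 16 * 4 ^ j"
        by (simp add: power2_eq_square power_mult_distrib[symmetric])
      finally have "real (card (A j)) \<le> real (16 * 4 ^ j)" by (simp only: of_nat_le_iff)
      then show "real (card (A j)) \<le> 16 * 4 ^ j" by simp
    qed (use B in simp)
    also have "\<dots> = 16 * 4 ^ M * B (M - j)"
      using that by (simp flip: power_add)
    finally show ?thesis .
  qed
  have "(\<Sum>b\<in>grid M - {a}. h (grid_point a - grid_point b))
      \<le> (\<Sum>b\<in>(\<Union>j\<in>{..<M}. A j). h (grid_point a - grid_point b))"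
    by (rule sum_mono2) (use sub h0 in auto)
  also have "\<dots> \<le> (\<Sum>j<M. \<Sum>b\<in>A j. h (grid_point a - grid_point b))"
  proof -
    have "(\<Union>j\<in>{..<M}. A j) = snd ` (SIGMA j:{..<M}. A j)" by force
    then have "(\<Sum>b\<in>(\<Union>j\<in>{..<M}. A j). h (grid_point a - grid_point b))
        \<le> (\<Sum>z\<in>(SIGMA j:{..<M}. A j). h (grid_point a - grid_point (snd z)))"
      using sum_image_le[of "SIGMA j:{..<M}. A j" "\<lambda>b. h (grid_point a - grid_point b)" snd] h0
      by (simp add: o_def)
    then show ?thesis by (simp add: sum.Sigma case_prod_beta)
  qed
  also have "\<dots> \<le> (\<Sum>j<M. 16 * 4 ^ M * B (M - j))"
    by (rule sum_mono) (use Aj in auto)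
  also have "\<dots> = 16 * 4 ^ M * (\<Sum>j<M. B (M - j))" by (simp add: sum_distrib_left)
  also have "(\<Sum>j<M. B (M - j)) = (\<Sum>j\<in>{1..M}. B j)"
    by (rule sum.reindex_bij_witness[of _ "\<lambda>j. M - j" "\<lambda>j. M - j"]) auto
  also have "\<dots> \<le> suminf B" by (rule sum_le_suminf) (use B in auto)
  finally show ?thesis by simp
qed

end

section \<open>Averaging the return probability over the grid\<close>

context stratified_environment
begin

text \<open>Positivity of \<open>\<Sum>a,b. cis ((\<theta>\<^sub>a - \<theta>\<^sub>b) \<bullet> x) = \<bar>\<Sum>a. cis (\<theta>\<^sub>a \<bullet> x)\<bar>\<^sup>2\<close> replaces Fourier inversion: the return
  probability is bounded by an average over differences of grid frequencies near the origin.\<close>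

lemma return_le_grid:
  fixes \<theta> :: "'c \<Rightarrow> real ^ 'd"
  assumes G: "finite G"
  shows "(real (card G))\<^sup>2 * pmf (law n) (0, 0) \<le> (\<Sum>a\<in>G. \<Sum>b\<in>G. Re (fourier (\<theta> a - \<theta> b) n 0))"
proof -
  define F where "F z = (\<Sum>a\<in>G. \<Sum>b\<in>G. Re (wave (\<theta> a - \<theta> b) 0 z))" for z
  have F: "F (x, y) = (if y = 0 then (norm (\<Sum>a\<in>G. cis (\<theta> a \<bullet> real_vec x)))\<^sup>2 else 0)" for x y
  proof -
    define u where "u a = cis (\<theta> a \<bullet> real_vec x)" for a
    have "(\<Sum>a\<in>G. u a) * cnj (\<Sum>a\<in>G. u a) = (\<Sum>a\<in>G. \<Sum>b\<in>G. u a * cnj (u b))"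
      by (simp add: sum_product cnj_sum)
    also have "\<dots> = (\<Sum>a\<in>G. \<Sum>b\<in>G. cis ((\<theta> a - \<theta> b) \<bullet> real_vec x))"
      by (simp add: u_def cis_cnj cis_mult inner_diff_left)
    finally have "complex_of_real ((norm (\<Sum>a\<in>G. u a))\<^sup>2) =
        (\<Sum>a\<in>G. \<Sum>b\<in>G. cis ((\<theta> a - \<theta> b) \<bullet> real_vec x))"
      by (simp only: complex_norm_square)
    then have "(norm (\<Sum>a\<in>G. u a))\<^sup>2 = Re (\<Sum>a\<in>G. \<Sum>b\<in>G. cis ((\<theta> a - \<theta> b) \<bullet> real_vec x))"
      by (metis Re_complex_of_real)
    then show ?thesis by (simp add: F_def wave_def u_def Re_sum)
  qed
  have Fint: "integrable (measure_pmf (law n)) (\<lambda>z. Re (wave v 0 z))" for v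
    by (rule integrable_pmf_bounded[where B = 1])
       (use norm_wave abs_Re_le_cmod order_trans in \<open>auto intro: order_trans[OF abs_Re_le_cmod norm_wave]\<close>)
  have "(real (card G))\<^sup>2 * pmf (law n) (0, 0) = (\<integral>z. (real (card G))\<^sup>2 * indicator {(0, 0)} z \<partial>law n)"
    by (simp add: measure_pmf_single)
  also have "\<dots> \<le> (\<integral>z. F z \<partial>law n)"
  proof (rule integral_mono)
    show "integrable (measure_pmf (law n)) (\<lambda>z. (real (card G))\<^sup>2 * indicator {(0, 0)} z)"
      by (rule integrable_pmf_bounded[where B = "(real (card G))\<^sup>2"]) (simp add: indicator_def)
    show "integrable (measure_pmf (law n)) F"
      unfolding F_def using Fint by simp
    fix z :: "(int ^ 'd) \<times> int"
    obtain x y where z: "z = (x, y)" by force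
    \<comment> \<open>At the origin every wave equals \<open>1\<close>, so \<open>F\<close> takes
      the value \<open>(real (card G))\<^sup>2\<close> there; elsewhere it is nonnegative.\<close>
    have "real_vec 0 = (0 :: real ^ 'd)" by (simp add: real_vec_def vec_eq_iff)
    then show "(real (card G))\<^sup>2 * indicator {(0, 0)} z \<le> F z"
      by (auto simp: z F indicator_def)
  qed
  also have "\<dots> = (\<Sum>a\<in>G. \<Sum>b\<in>G. Re (fourier (\<theta> a - \<theta> b) n 0))"
    unfolding F_def fourier_def integral_complex_parts(1)[OF norm_wave]
    using Fint by simp
  finally show ?thesis .
qed

text \<open>The \<open>4 ^ M\<close> diagonal pairs only admit the trivial bound
  \<open>1 / (1 - s)\<close>, but their share among all \<open>16 ^ M\<close> pairs vanishes as
  \<open>M\<close> grows with \<open>s\<close> fixed. The off-diagonal average is bounded uniformly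
  in \<open>s\<close> and \<open>M\<close>.\<close>

theorem summable_return_if_green_multiscale:
  fixes B :: "nat \<Rightarrow> real"
  assumes d: "2 \<le> CARD('d)" and \<epsilon>: "0 < \<epsilon>"
    and B: "summable B" "\<And>m. 0 \<le> B m"
    and green: "\<And>s m v. 0 < s \<Longrightarrow> s < 1 \<Longrightarrow> \<epsilon> / 2 ^ m \<le> norm v \<Longrightarrow> norm v \<le> 2 * \<epsilon>
      \<Longrightarrow> norm (green s v 0) \<le> 4 ^ m * B m"
  shows "summable (\<lambda>n. pmf (law n) (0, 0))"
proof (rule summable_of_Abel_bound)
  fix s :: real and N assume s: "0 < s" "s < 1"
  have "\<not> card (UNIV :: 'd set) \<le> Suc 0" using d by simp
  then obtain i1 i2 :: 'd where i12: "i1 \<noteq> i2"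
    using card_le_Suc0_iff_eq[OF finite[of "UNIV :: 'd set"]] by blast
  let ?P = "\<Sum>n<N. s ^ n * pmf (law n) (0, 0)"
  have "?P \<le> 1 / (1 - s) * (1 / 4) ^ M + 16 * suminf B" for M
  proof -
    define G where "G = grid M"
    define \<theta> where "\<theta> = grid_point i1 i2 \<epsilon> M"
    define h where "h v = norm (green s v 0)" for v
    have cG: "real (card G) = 4 ^ M"
      by (simp add: G_def card_grid)
    have finG: "finite G" by (simp add: G_def)
    let ?R = "\<lambda>n. \<Sum>a\<in>G. \<Sum>b\<in>G. Re (fourier (\<theta> a - \<theta> b) n 0)"
    have R: "(4 ^ M)\<^sup>2 * pmf (law n) (0, 0) \<le> ?R n" for n
      using return_le_grid[OF finG, of n \<theta>] by (simp add: cG)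
    have R0: "0 \<le> s ^ n * ?R n" for n
    proof (rule mult_nonneg_nonneg)
      show "0 \<le> ?R n" by (rule order_trans[OF _ R]) simp
    qed (use s in simp)
    have sums: "(\<lambda>n. s ^ n * ?R n) sums (\<Sum>a\<in>G. \<Sum>b\<in>G. Re (green s (\<theta> a - \<theta> b) 0))"
      unfolding sum_distrib_left by (intro sums_sum Re_green s)
    have "(4 ^ M)\<^sup>2 * ?P = (\<Sum>n<N. s ^ n * ((4 ^ M)\<^sup>2 * pmf (law n) (0, 0)))"
      by (simp add: sum_distrib_left mult_ac)
    also have "\<dots> \<le> (\<Sum>n<N. s ^ n * ?R n)"
      by (intro sum_mono mult_left_mono R) (use s in simp)
    also have "\<dots> \<le> (\<Sum>n. s ^ n * ?R n)"
      by (rule sum_le_suminf) (use sums_summable[OF sums] R0 in auto)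
    also have "\<dots> = (\<Sum>a\<in>G. \<Sum>b\<in>G. Re (green s (\<theta> a - \<theta> b) 0))"
      using sums_unique[OF sums] by simp
    also have "\<dots> \<le> (\<Sum>a\<in>G. \<Sum>b\<in>G. h (\<theta> a - \<theta> b))"
      unfolding h_def by (intro sum_mono complex_Re_le_cmod)
    also have "\<dots> \<le> (\<Sum>a\<in>G. 1 / (1 - s) + 16 * 4 ^ M * suminf B)"
    proof (rule sum_mono)
      fix a assume a: "a \<in> G"
      have "(\<Sum>b\<in>G. h (\<theta> a - \<theta> b)) = h (\<theta> a - \<theta> a) + (\<Sum>b\<in>G - {a}. h (\<theta> a - \<theta> b))"
        using finG a by (rule sum.remove)
      also have "h (\<theta> a - \<theta> a) \<le> 1 / (1 - s)"
        using norm_green[OF s, of 0 0] by (simp add: h_def)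
      also have "(\<Sum>b\<in>G - {a}. h (\<theta> a - \<theta> b)) \<le> 16 * 4 ^ M * suminf B"
        unfolding G_def \<theta>_def
        by (rule grid_off_diagonal[OF i12 \<epsilon> B]) (use green[OF s] a in \<open>auto simp: h_def G_def\<close>)
      finally show "(\<Sum>b\<in>G. h (\<theta> a - \<theta> b)) \<le> 1 / (1 - s) + 16 * 4 ^ M * suminf B" by simp
    qed
    also have "\<dots> = (4 ^ M)\<^sup>2 * (1 / (1 - s) * (1 / 4) ^ M + 16 * suminf B)"
    proof -
      have "(4 ^ M)\<^sup>2 * (1 / 4) ^ M = (4 ^ M :: real)"
        by (simp add: power2_eq_square power_one_over)
      then have "(4 ^ M)\<^sup>2 * (1 / (1 - s) * (1 / 4) ^ M) = 4 ^ M * (1 / (1 - s))"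
        by (metis mult.commute mult.left_commute)
      then show ?thesis
        by (simp only: sum_constant cG distrib_left) (simp add: power2_eq_square)
    qed
    finally show ?thesis by (simp only: mult_le_cancel_left_pos zero_less_power zero_less_numeral)
  qed
  moreover have "(\<lambda>M. 1 / (1 - s) * (1 / 4) ^ M + 16 * suminf B) \<longlonglongrightarrow> 1 / (1 - s) * 0 + 16 * suminf B"
    by (intro tendsto_intros LIMSEQ_power_zero) simp
  ultimately show "?P \<le> 16 * suminf B"
    by (auto intro: LIMSEQ_le_const)
qed simp

end

section \<open>Transience from multiscale control of the environment\<close>

text \<open>At spatial frequency \<open>2\<^sup>-\<^sup>m\<close> the vertical motion is killed at rate \<open>\<kappa> 4\<^sup>-\<^sup>m\<close>; \<open>G\<close> stands for the Green
  function of the killed walk on the right half line.\<close>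

definition multiscale_bound :: "real \<Rightarrow> real \<Rightarrow> (nat \<Rightarrow> real) \<Rightarrow> bool" where
  "multiscale_bound c \<kappa> D \<longleftrightarrow> (\<exists>B. summable B \<and> (\<forall>m. 0 \<le> B m) \<and>
     (\<forall>m G. (\<forall>n. 0 \<le> G n) \<longrightarrow> (\<forall>n. c * G 0 \<le> (\<Sum>j<n. D j) + D n * G n) \<longrightarrow>
        (\<forall>n. \<kappa> * (1 / 4) ^ m * (\<Sum>j=1..n. G j) \<le> 1) \<longrightarrow> c * G 0 \<le> 4 ^ m * B m))"

text \<open>The resistance bound is averaged over \<open>n = 1..2 ^ m\<close>: the resistance costs
  at most \<open>2 ^ m\<close>, and the mass bound makes the average of \<open>G n\<close> at most
  \<open>2 ^ m / \<kappa>\<close>.\<close>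

lemma multiscale_bound_flat:
  assumes \<kappa>: "0 < \<kappa>"
  shows "multiscale_bound c \<kappa> (\<lambda>_. 1)"
  unfolding multiscale_bound_def
proof (intro exI[of _ "\<lambda>m. (1 + 1 / \<kappa>) * (1 / 2) ^ m"] conjI allI impI)
  show "summable (\<lambda>m. (1 + 1 / \<kappa>) * (1 / 2) ^ m)" by (intro summable_mult summable_geometric) simp
  fix m show "0 \<le> (1 + 1 / \<kappa>) * (1 / 2) ^ m" using \<kappa> by simp
next
  fix m and G :: "nat \<Rightarrow> real"
  assume G: "\<forall>n. 0 \<le> G n" "\<forall>n. c * G 0 \<le> (\<Sum>j<n. 1) + 1 * G n"
    "\<forall>n. \<kappa> * (1 / 4) ^ m * (\<Sum>j=1..n. G j) \<le> 1"
  define L where "L = (2::nat) ^ m"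
  have L: "real L = 2 ^ m" "0 < real L" by (simp_all add: L_def)
  have LL: "real L * real L = 4 ^ m" by (simp add: L flip: power_mult_distrib)
  have "real L * (c * G 0) = (\<Sum>n=1..L. c * G 0)" by simp
  also have "\<dots> \<le> (\<Sum>n=1..L. real L + G n)"
  proof (rule sum_mono)
    fix n assume "n \<in> {1..L}"
    then show "c * G 0 \<le> real L + G n" using G(2)[rule_format, of n] by simp
  qed
  also have "\<dots> = real L * real L + (\<Sum>n=1..L. G n)" by (simp add: sum.distrib)
  also have "(\<Sum>n=1..L. G n) \<le> real L * real L / \<kappa>"
    using G(3)[rule_format, of L] \<kappa> by (simp add: LL field_simps)
  finally have "real L * (c * G 0) \<le> real L * (real L * (1 + 1 / \<kappa>))" by (simp add: algebra_simps)
  then have "c * G 0 \<le> real L * (1 + 1 / \<kappa>)" using L(2) by simp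
  also have "real L = 4 ^ m * (1 / 2) ^ m" by (simp add: L flip: power_mult_distrib)
  finally show "c * G 0 \<le> 4 ^ m * ((1 + 1 / \<kappa>) * (1 / 2) ^ m)" by (simp add: mult_ac)
qed

text \<open>With \<open>n\<close> proportional to \<open>m\<close>, a point \<open>y \<le> n\<close> of resistance at most \<open>n\<^sup>-\<^sup>2\<close> is cheap to reach, and the mass
  spent there is at most \<open>4\<^sup>m / \<kappa>\<close>.\<close>

lemma multiscale_bound_valley:
  assumes \<kappa>: "0 < \<kappa>" and l: "1 \<le> l" and D: "\<And>n. 0 \<le> D n" "\<And>n. D n \<le> (2 ^ l) ^ n"
    and valley: "\<And>n. n0 \<le> n \<Longrightarrow> \<exists>y\<in>{1..n}. D y \<le> 1 / (real n)\<^sup>2"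
  shows "multiscale_bound c \<kappa> D"
proof -
  \<comment> \<open>From \<open>m0\<close> on, \<open>n = m div l\<close> exceeds \<open>n0\<close>,
    so that \<open>valley\<close> applies; the finitely many smaller scales use the resistance bound
    at \<open>n = 1\<close>.\<close>
  define m0 where "m0 = l * Suc n0"
  define B where "B m = (if m < m0 then 1 + 2 ^ l / \<kappa> else (1 / 2) ^ m + 4 * (real l)\<^sup>2 / \<kappa> * (1 / (real m)\<^sup>2))" for m
  have "summable (\<lambda>m. (1 / 2 :: real) ^ m + 4 * (real l)\<^sup>2 / \<kappa> * (1 / (real m)\<^sup>2))"
    by (intro summable_add summable_mult summable_geometric)
       (use inverse_power_summable[of 2, where 'a = real] in \<open>simp_all add: field_simps\<close>)
  then have "summable B"
    by (rule summable_cong[THEN iffD1, rotated])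
       (auto simp: B_def eventually_sequentially intro!: exI[of _ m0])
  moreover have "0 \<le> B m" for m using \<kappa> by (simp add: B_def)
  moreover have "c * G 0 \<le> 4 ^ m * B m"
    if G: "\<forall>n. 0 \<le> G n" "\<forall>n. c * G 0 \<le> (\<Sum>j<n. D j) + D n * G n"
      "\<forall>n. \<kappa> * (1 / 4) ^ m * (\<Sum>j=1..n. G j) \<le> 1" for m and G :: "nat \<Rightarrow> real"
  proof -
    have Gy: "G y \<le> 4 ^ m / \<kappa>" if "1 \<le> y" for y
    proof -
      have "G y \<le> (\<Sum>j=1..y. G j)" by (rule member_le_sum) (use that G in auto)
      also have "\<dots> \<le> 4 ^ m / \<kappa>"
        using G(3)[rule_format, of y] \<kappa> by (simp add: power_one_over field_simps)
      finally show ?thesis .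
    qed
    show ?thesis
    proof (cases "m < m0")
      case True
      have D0: "D 0 \<le> 1" using D(2)[of 0] by simp
      have "c * G 0 \<le> D 0 + D 1 * G 1" using G(2)[rule_format, of 1] by simp
      also have "\<dots> \<le> 1 + 2 ^ l * (4 ^ m / \<kappa>)"
        using D(2)[of 1] G(1) by (intro add_mono D0 mult_mono Gy) auto
      also have "\<dots> \<le> 4 ^ m * 1 + 2 ^ l * (4 ^ m / \<kappa>)" by simp
      also have "\<dots> = 4 ^ m * B m" using True by (simp add: B_def algebra_simps)
      finally show ?thesis .
    next
      case False
      \<comment> \<open>Resistances grow at most like \<open>(2 ^ l) ^ n\<close>, so this choice
        keeps the accumulated resistance at most \<open>2 ^ m\<close>, while \<open>n\<close>
        remains of order \<open>m\<close>.\<close>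
      define n where "n = m div l"
      have ln: "l * n \<le> m" by (simp add: n_def)
      have nb: "Suc n0 \<le> n" using False l
        by (simp add: n_def m0_def less_eq_div_iff_mult_less_eq mult.commute del: mult_Suc_right)
      have mn: "real m \<le> 2 * real l * real n"
      proof -
        have "m = l * n + m mod l" by (simp add: n_def)
        moreover have "m mod l \<le> l" using l by simp
        moreover have "l \<le> l * n" using nb by simp
        moreover have "2 * l * n = l * n + l * n" by simp
        ultimately have "m \<le> 2 * l * n" by linarith
        then show ?thesis by (metis of_nat_le_iff of_nat_mult of_nat_numeral)
      qed
      have m1: "0 < m" using False l by (simp add: m0_def)
      obtain y where y: "1 \<le> y" "y \<le> n" "D y \<le> 1 / (real n)\<^sup>2"
        using valley[of n] nb by auto
      have "(\<Sum>j<y. D j) \<le> (\<Sum>j<n. D j)" by (rule sum_mono2) (use y D in auto)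
      also have "\<dots> \<le> (2 ^ l) ^ n"
      proof (induction n)
        case (Suc n)
        have "(2 ^ l) ^ n + D n \<le> (2::real) ^ l * (2 ^ l) ^ n"
        proof -
          have "(2::real) ^ 1 \<le> 2 ^ l" using l by (intro power_increasing) auto
          then have "2 * (2 ^ l) ^ n \<le> (2::real) ^ l * (2 ^ l) ^ n" by (intro mult_right_mono) auto
          then show ?thesis using D(2)[of n] by linarith
        qed
        with Suc show ?case by simp
      qed simp
      also have "\<dots> \<le> 2 ^ m" using ln by (simp flip: power_mult)
      also have "(2::real) ^ m = 4 ^ m * (1 / 2) ^ m" by (simp flip: power_mult_distrib)
      finally have first: "(\<Sum>j<y. D j) \<le> 4 ^ m * (1 / 2) ^ m" .
      have "D y * G y \<le> 1 / (real n)\<^sup>2 * (4 ^ m / \<kappa>)"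
        by (intro mult_mono y(3) Gy y(1)) (use G(1) in auto)
      also have "1 / (real n)\<^sup>2 \<le> 4 * (real l)\<^sup>2 * (1 / (real m)\<^sup>2)"
      proof -
        have "(real m)\<^sup>2 \<le> (2 * real l * real n)\<^sup>2" using mn by (intro power_mono) auto
        then show ?thesis using nb m1 by (simp add: field_simps power_mult_distrib)
      qed
      finally have "D y * G y \<le> 4 * (real l)\<^sup>2 * (1 / (real m)\<^sup>2) * (4 ^ m / \<kappa>)"
        using \<kappa> by (simp add: mult_right_mono divide_right_mono)
      with first have "(\<Sum>j<y. D j) + D y * G y \<le> 4 ^ m * B m"
        using False by (simp add: B_def algebra_simps)
      with G(2) show ?thesis by (metis order_trans)
    qed
  qed
  ultimately show ?thesis unfolding multiscale_bound_def by blast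
qed

section \<open>Killing rates at each frequency scale\<close>

context stratified_environment
begin

lemma Re_char_fun: "Re (char_fun v y) = (\<integral>k. cos (v \<bullet> real_vec k) \<partial>\<mu> y)"
  unfolding char_fun_def by (subst integral_complex_parts(1)[where B = 1]) auto

theorem transient_if_multiscale_bound:
  assumes d: "2 \<le> CARD('d)" and \<eta>: "0 < \<eta>" and r: "\<And>y. \<eta> \<le> r y"
    and sm: "\<And>y. (\<lambda>k. norm (real_vec k) ^ max CARD('d) 3 * pmf (\<mu> y) k) summable_on UNIV"
    and bd: "\<And>y. (\<Sum>\<^sub>\<infinity>k\<in>UNIV. norm (real_vec k) ^ max CARD('d) 3 * pmf (\<mu> y) k) \<le> 1 / \<eta>"
    and spec: "\<And>y. matrix_spectrum (second_moment_matrix (\<mu> y)) \<subseteq> {\<eta>..}"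
    and env: "\<And>\<kappa>. 0 < \<kappa> \<Longrightarrow> multiscale_bound (p 0) \<kappa> (resistance p q)"
    and mc: "markov_chain N S (strat_trans p q r \<mu>) (0, 0)"
  shows "transient_at N S (0, 0)"
proof -
  \<comment> \<open>Frequencies up to \<open>2 * \<epsilon>\<close> must lie in the range of
    \<open>Re_char_le\<close>, and \<open>\<epsilon> \<le> 1\<close> keeps the loss
    \<open>?c\<close> at most \<open>1\<close>. With \<open>r y \<ge> \<eta>\<close> and
    \<open>norm v \<ge> \<epsilon> / 2 ^ m\<close>, the rate \<open>r y * ?c\<close> is at least
    \<open>\<kappa> * (1 / 4) ^ m\<close>.\<close>
  define \<epsilon> where "\<epsilon> = min (3 * \<eta>\<^sup>2 / 4) 1"
  define \<kappa> where "\<kappa> = \<eta>\<^sup>2 * \<epsilon>\<^sup>2 / 4"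
  have \<eta>1: "\<eta> \<le> 1" using r[of 0] pos[of 0] sum1[of 0] by linarith
  have \<epsilon>: "0 < \<epsilon>" "\<epsilon> \<le> 1" "2 * \<epsilon> \<le> 3 * \<eta>\<^sup>2 / 2" using \<eta> by (auto simp: \<epsilon>_def min_def)
  have \<kappa>: "0 < \<kappa>" using \<eta> \<epsilon> by (simp add: \<kappa>_def)
  obtain B where B: "summable B" "\<And>m. 0 \<le> B m"
    and BG: "\<And>m G. \<lbrakk>\<And>n. 0 \<le> G n; \<And>n. p 0 * G 0 \<le> (\<Sum>j<n. resistance p q j) + resistance p q n * G n;
        \<And>n. \<kappa> * (1 / 4) ^ m * (\<Sum>j=1..n. G j) \<le> 1\<rbrakk> \<Longrightarrow> p 0 * G 0 \<le> 4 ^ m * B m"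
    using env[OF \<kappa>] unfolding multiscale_bound_def by metis
  have "summable (\<lambda>n. pmf (law n) (0, 0))"
  proof (rule summable_return_if_green_multiscale[OF d \<epsilon>(1), where B = "\<lambda>m. B m / p 0"])
    show "summable (\<lambda>m. B m / p 0)" using B by (intro summable_divide)
    show "0 \<le> B m / p 0" for m using B pos(1)[of 0] by simp
    fix s :: real and m and v :: "real ^ 'd"
    assume s: "0 < s" "s < 1" and v: "\<epsilon> / 2 ^ m \<le> norm v" "norm v \<le> 2 * \<epsilon>"
    define w where "w = \<kappa> * (1 / 4) ^ m"
    interpret killed_flow p q "\<lambda>y. norm (green s v y)" w
    proof (rule killed_flow_green[OF s])
      show "0 \<le> w" using \<kappa> by (simp add: w_def)
      fix y
      let ?c = "\<eta> * (norm v)\<^sup>2 / 4"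
      have "Re (char_fun v y) \<le> 1 - ?c"
        unfolding Re_char_fun by (rule Re_char_le[OF \<eta> _ sm bd spec]) (use v \<epsilon> in auto)
      moreover have "?c \<le> 1"
      proof -
        have "(norm v)\<^sup>2 \<le> (2 * \<epsilon>)\<^sup>2" using v by (intro power_mono) auto
        also have "\<dots> \<le> 2\<^sup>2" using \<epsilon> by (intro power_mono) auto
        finally have "\<eta> * (norm v)\<^sup>2 \<le> 1 * 2\<^sup>2" using \<eta> \<eta>1 by (intro mult_mono) auto
        then show ?thesis by simp
      qed
      ultimately have "p y + q y + r y * ?c \<le> norm (1 - of_real s * of_real (r y) * char_fun v y)"
        using \<eta> by (intro norm_one_minus_ge[OF s]) auto
      moreover have "w \<le> r y * ?c"
      proof -
        have "(\<epsilon> / 2 ^ m)\<^sup>2 \<le> (norm v)\<^sup>2" using v \<epsilon> by (intro power_mono) auto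
        moreover have "(\<epsilon> / 2 ^ m)\<^sup>2 = \<epsilon>\<^sup>2 * (1 / 4) ^ m"
        proof -
          have "(1 / 2 ^ m)\<^sup>2 = (1 / 4 :: real) ^ m"
            by (simp add: power_one_over power2_eq_square flip: power_mult_distrib)
          then show ?thesis by (simp add: power_divide)
        qed
        ultimately have "\<eta>\<^sup>2 / 4 * (\<epsilon>\<^sup>2 * (1 / 4) ^ m) \<le> \<eta>\<^sup>2 / 4 * (norm v)\<^sup>2"
          by (intro mult_left_mono) auto
        then have "w \<le> \<eta> * ?c" by (simp add: w_def \<kappa>_def power2_eq_square mult_ac)
        also have "\<dots> \<le> r y * ?c" using r[of y] \<eta> by (intro mult_right_mono) auto
        finally show ?thesis .
      qed
      ultimately show "p y + q y + w \<le> norm (1 - of_real s * of_real (r y) * char_fun v y)"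
        by linarith
    qed
    have "p 0 * norm (green s v (int 0)) \<le> 4 ^ m * B m"
      by (rule BG[of "\<lambda>n. norm (green s v (int n))" m])
         (use green_le_resistance killed_sum_le in \<open>auto simp: w_def\<close>)
    then show "norm (green s v 0) \<le> 4 ^ m * (B m / p 0)"
      using pos(1)[of 0] by (simp add: field_simps)
  qed
  then show ?thesis using mc by (rule transient_if_summable_return)
qed

end

section \<open>Sums of bounded i.i.d. random variables\<close>

locale bounded_iid = prob_space M for M :: "'w measure" +
  fixes Y :: "nat \<Rightarrow> 'w \<Rightarrow> real" and C :: real
  assumes indep: "indep_vars (\<lambda>_. borel) Y UNIV"
    and ident: "distr M borel (Y n) = distr M borel (Y 0)"
    and C: "0 < C"
    and bounded: "AE \<omega> in M. \<bar>Y n \<omega>\<bar> \<le> C"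
begin

lemma Y_measurable [measurable]: "Y n \<in> borel_measurable M"
  using indep by (simp add: indep_vars_def)

definition Z :: "nat \<Rightarrow> 'w \<Rightarrow> real" where "Z n \<omega> = (\<Sum>i<n. Y i \<omega>)"

lemma Z_measurable [measurable]: "Z n \<in> borel_measurable M"
  unfolding Z_def by measurable

lemma all_bounded: "AE \<omega> in M. \<forall>n. \<bar>Y n \<omega>\<bar> \<le> C"
  using bounded by (simp add: AE_all_countable)

lemma Z_le: "(\<forall>n. \<bar>Y n \<omega>\<bar> \<le> C) \<Longrightarrow> \<bar>Z n \<omega>\<bar> \<le> C * real n"
proof (induction n)
  case (Suc n)
  then have "\<bar>Z n \<omega>\<bar> \<le> C * real n" "\<bar>Y n \<omega>\<bar> \<le> C" by auto
  then show ?case by (simp add: Z_def algebra_simps)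
qed (simp add: Z_def)

lemma Hoeffding_Z:
  assumes "0 \<le> \<epsilon>" "0 < n"
  shows "prob {\<omega> \<in> space M. Z n \<omega> \<le> real n * expectation (Y 0) - \<epsilon>} \<le> exp (- 2 * \<epsilon>\<^sup>2 / (real n * (2 * C)\<^sup>2))"
proof -
  interpret H: Hoeffding_ineq_iid M "{..<n}" Y "Y 0" "- C" C "expectation (Y 0)"
  proof unfold_locales
    show "indep_vars (\<lambda>_. borel) Y {..<n}" by (rule indep_vars_subset[OF indep]) simp
    show "AE x in M. Y 0 x \<in> {- C..C}" using bounded[of 0] by eventually_elim (simp add: abs_le_iff)
    show "distr M borel (Y i) = distr M borel (Y 0)" for i by (rule ident)
  qed auto
  have "- C < C" "{..<n} \<noteq> {}" using C assms(2) by auto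
  from H.Hoeffding_ineq_le[OF assms(1) this] show ?thesis
    unfolding Z_def mult_2 by (simp only: card_lessThan diff_minus_eq_add)
qed

text \<open>By Hoeffding's inequality and Borel-Cantelli, \<open>Z n\<close> eventually exceeds
  \<open>n\<close> times half the mean, so the terms are dominated by a geometric series.\<close>

lemma summable_exp_neg_Z:
  assumes "0 < expectation (Y 0)"
  shows "AE \<omega> in M. summable (\<lambda>n. exp (- Z n \<omega>))"
proof -
  define m where "m = expectation (Y 0)"
  \<comment> \<open>Hoeffding's exponent per step for a deviation of \<open>n * m / 2\<close> and
    variables of range \<open>2 * C\<close>.\<close>
  define c where "c = m\<^sup>2 / (8 * C\<^sup>2)"
  have m: "0 < m" and c: "0 < c" using assms C by (auto simp: m_def c_def)
  define A where "A n = {\<omega> \<in> space M. Z n \<omega> \<le> real n * m / 2}" for n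
  have A: "prob (A n) \<le> exp (- c) ^ n" for n
  proof (cases "n = 0")
    case False
    then have "prob (A n) \<le> exp (- 2 * (real n * m / 2)\<^sup>2 / (real n * (2 * C)\<^sup>2))"
      using Hoeffding_Z[of "real n * m / 2" n] m by (simp add: A_def m_def)
    also have "- 2 * (real n * m / 2)\<^sup>2 / (real n * (2 * C)\<^sup>2) = real n * (- c)"
      using False C by (simp add: c_def field_simps power2_eq_square)
    finally show ?thesis by (simp only: exp_of_nat_mult)
  qed simp
  have "AE \<omega> in M. eventually (\<lambda>n. \<omega> \<in> space M - A n) sequentially"
  proof (rule borel_cantelli_AE1)
    show "A n \<in> sets M" for n unfolding A_def by measurable
    show "emeasure M (A n) < \<infinity>" for n by (simp add: emeasure_eq_measure)
    show "summable (\<lambda>n. prob (A n))"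
      by (rule summable_comparison_test[OF _ summable_geometric[of "exp (- c)"]]) (use A c in auto)
  qed
  then show ?thesis
  proof eventually_elim
    case (elim \<omega>)
    show "summable (\<lambda>n. exp (- Z n \<omega>))"
    proof (rule summable_comparison_test_ev[OF _ summable_geometric[of "exp (- m / 2)"]])
      show "eventually (\<lambda>n. norm (exp (- Z n \<omega>)) \<le> exp (- m / 2) ^ n) sequentially"
        using elim
      proof eventually_elim
        case (elim n)
        then have "\<not> Z n \<omega> \<le> real n * m / 2" by (auto simp: A_def)
        then have "- Z n \<omega> \<le> real n * (- m / 2)" by linarith
        then show ?case by (simp flip: exp_of_nat_mult)
      qed
    qed (use m in simp)
  qed
qed

lemma Y_square_integrable: "integrable M (\<lambda>\<omega>. (Y n \<omega>)\<^sup>2)"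
proof (rule integrable_const_bound[where B = "C\<^sup>2"])
  show "AE \<omega> in M. norm ((Y n \<omega>)\<^sup>2) \<le> C\<^sup>2"
    using bounded[of n]
  proof eventually_elim
    case (elim \<omega>)
    then have "\<bar>Y n \<omega>\<bar>\<^sup>2 \<le> C\<^sup>2" by (intro power_mono) auto
    then show ?case by simp
  qed
qed measurable

lemma expectation_Y: "expectation (Y n) = expectation (Y 0)"
proof -
  have "expectation (Y n) = (\<integral>x. x \<partial>distr M borel (Y n))" by (simp add: integral_distr)
  also have "\<dots> = expectation (Y 0)" unfolding ident[of n] by (simp add: integral_distr)
  finally show ?thesis .
qed

lemma expectation_Y_square: "expectation (\<lambda>\<omega>. (Y n \<omega>)\<^sup>2) = expectation (\<lambda>\<omega>. (Y 0 \<omega>)\<^sup>2)"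
proof -
  have "expectation (\<lambda>\<omega>. (Y n \<omega>)\<^sup>2) = (\<integral>x. x\<^sup>2 \<partial>distr M borel (Y n))" by (simp add: integral_distr)
  also have "\<dots> = expectation (\<lambda>\<omega>. (Y 0 \<omega>)\<^sup>2)" unfolding ident[of n] by (simp add: integral_distr)
  finally show ?thesis .
qed

lemma degenerate:
  assumes "expectation (\<lambda>\<omega>. (Y 0 \<omega>)\<^sup>2) = 0"
  shows "AE \<omega> in M. \<forall>n. Y n \<omega> = 0"
proof -
  have "AE \<omega> in M. Y n \<omega> = 0" for n
  proof -
    have "expectation (\<lambda>\<omega>. (Y n \<omega>)\<^sup>2) = 0" using assms expectation_Y_square[of n] by simp
    then have "AE \<omega> in M. (Y n \<omega>)\<^sup>2 = 0"
      using integral_nonneg_eq_0_iff_AE[OF Y_square_integrable[of n]] by simp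
    then show ?thesis by simp
  qed
  then show ?thesis by (simp add: AE_all_countable)
qed

end

section \<open>The standard normal distribution function\<close>

lemma cdf_std_normal_less_1: "cdf std_normal_distribution x < 1"
proof -
  interpret real_distribution std_normal_distribution by (rule real_dist_normal_dist)
  have "measure std_normal_distribution {..x} \<noteq> 1"
  proof
    assume "measure std_normal_distribution {..x} = 1"
    then have "AE y in std_normal_distribution. y \<in> {..x}" by (rule prob_eq_1[THEN iffD1, rotated]) simp
    then have "AE y in lborel. y \<le> x"
      by (subst (asm) AE_density) (auto simp: normal_density_pos)
    then have "AE y in lborel. y \<notin> {x<..x + 1}" by eventually_elim simp
    then have "{x<..x + 1} \<in> null_sets lborel" by (subst AE_iff_null_sets) auto
    then have "emeasure lborel {x<..x + 1} = 0" by blast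
    then show False by simp
  qed
  then show ?thesis using prob_le_1[of "{..x}"] by (simp add: cdf_def less_le)
qed

lemma isCont_cdf_std_normal: "isCont (cdf std_normal_distribution) x"
proof -
  interpret real_distribution std_normal_distribution by (rule real_dist_normal_dist)
  have "AE y in lborel. y \<noteq> x" by (rule AE_lborel_singleton)
  then have "AE y in std_normal_distribution. y \<noteq> x" by (subst AE_density) auto
  then have "measure std_normal_distribution {x} = 0"
    by (subst prob_eq_0) auto
  then show ?thesis by (simp add: isCont_cdf)
qed

section \<open>High points of a centered walk\<close>

locale centered_bounded_iid = bounded_iid +
  assumes centered: "expectation (Y 0) = 0" and var_pos: "0 < expectation (\<lambda>\<omega>. (Y 0 \<omega>)\<^sup>2)"
begin

definition \<sigma> :: real where "\<sigma> = sqrt (expectation (\<lambda>\<omega>. (Y 0 \<omega>)\<^sup>2))"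

lemma \<sigma>: "0 < \<sigma>" "\<sigma>\<^sup>2 = expectation (\<lambda>\<omega>. (Y 0 \<omega>)\<^sup>2)"
  using var_pos by (auto simp: \<sigma>_def)

text \<open>By the central limit theorem these probabilities converge to the standard normal
  distribution function at \<open>1\<close>, which is less than \<open>1\<close>;
  \<open>\<rho>\<close> is chosen strictly in between.\<close>

lemma prob_Z_small:
  obtains \<rho> n0 where "0 \<le> \<rho>" "\<rho> < 1"
    "\<And>n. n0 \<le> n \<Longrightarrow> prob {\<omega> \<in> space M. Z n \<omega> \<le> \<sigma> * sqrt (real n)} \<le> \<rho>"
proof -
  let ?S = "\<lambda>n \<omega>. (\<Sum>i<n. Y i \<omega>) / sqrt (real n * \<sigma>\<^sup>2)"
  have "weak_conv_m (\<lambda>n. distr M borel (?S n)) std_normal_distribution"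
  proof (rule central_limit_theorem_zero_mean[OF indep])
    show "expectation (Y n) = 0" for n using expectation_Y centered by simp
    then show "variance (Y n) = \<sigma>\<^sup>2" for n using expectation_Y_square \<sigma> by simp
  qed (use \<sigma> Y_square_integrable ident in auto)
  moreover note isCont_cdf_std_normal[of 1]
  ultimately have lim: "(\<lambda>n. cdf (distr M borel (?S n)) 1) \<longlonglongrightarrow> cdf std_normal_distribution 1"
    by (simp add: weak_conv_m_def weak_conv_def)
  obtain \<rho> where \<rho>: "cdf std_normal_distribution 1 < \<rho>" "\<rho> < 1"
    using dense[OF cdf_std_normal_less_1[of 1]] by blast
  have "eventually (\<lambda>n. cdf (distr M borel (?S n)) 1 < \<rho>) sequentially"
    using lim \<rho>(1) by (rule order_tendstoD)
  then obtain n0 where n0: "\<And>n. n0 \<le> n \<Longrightarrow> cdf (distr M borel (?S n)) 1 < \<rho>"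
    by (auto simp: eventually_sequentially)
  have "prob {\<omega> \<in> space M. Z n \<omega> \<le> \<sigma> * sqrt (real n)} \<le> \<rho>" if "max 1 n0 \<le> n" for n
  proof -
    have "cdf (distr M borel (?S n)) 1 = prob (?S n -` {..1} \<inter> space M)"
      by (simp add: cdf_def measure_distr)
    also have "?S n -` {..1} \<inter> space M = {\<omega> \<in> space M. Z n \<omega> \<le> \<sigma> * sqrt (real n)}"
      using \<sigma>(1) that by (auto simp: Z_def real_sqrt_mult divide_le_eq mult.commute)
    finally show ?thesis using n0[of n] that by simp
  qed
  moreover have "0 \<le> \<rho>" using \<rho>(1) by (simp add: cdf_def order_trans[OF measure_nonneg less_imp_le])
  ultimately show ?thesis using \<rho>(2) by (intro that[of \<rho> "max 1 n0"]) auto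
qed

text \<open>Doubly exponential block ends: the increment over a block dominates everything before it.\<close>

definition block_end :: "nat \<Rightarrow> nat" where "block_end k = 2 ^ (4 ^ k)"

definition block :: "nat \<Rightarrow> nat set" where "block k = {block_end k..<block_end (Suc k)}"

lemma block_end_mono: "j \<le> k \<Longrightarrow> block_end j \<le> block_end k"
  by (simp add: block_end_def)

lemma block_end_Suc: "block_end (Suc k) = block_end k ^ 4"
proof -
  have "(2 :: nat) ^ 4 ^ Suc k = 2 ^ (4 ^ k * 4)" by simp
  also have "\<dots> = (2 ^ 4 ^ k) ^ 4" by (rule power_mult)
  finally show ?thesis by (simp add: block_end_def)
qed

text \<open>The event involves one block only, which gives independence. Almost surely the sum
  before the block is at most \<open>C * b\<close> in modulus with \<open>b = block_end k\<close>,
  so outside \<open>bad k\<close> the walk ends the block above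
  \<open>\<sigma> * b\<^sup>2 - 2 * C * b\<close>.\<close>

definition bad :: "nat \<Rightarrow> 'a set" where
  "bad k = {\<omega> \<in> space M. (\<Sum>i\<in>block k. Y i \<omega>) \<le> \<sigma> * (real (block_end k))\<^sup>2 - C * real (block_end k)}"

lemma bad_event [measurable]: "bad k \<in> events"
  unfolding bad_def by measurable

lemma Z_block: "Z (block_end (Suc k)) \<omega> = Z (block_end k) \<omega> + (\<Sum>i\<in>block k. Y i \<omega>)"
proof -
  have "{..<block_end (Suc k)} = {..<block_end k} \<union> block k"
    using block_end_mono[of k "Suc k"] by (auto simp: block_def)
  moreover have "{..<block_end k} \<inter> block k = {}" by (auto simp: block_def)
  moreover have "finite (block k)" by (simp add: block_def)
  ultimately show ?thesis unfolding Z_def by (simp add: sum.union_disjoint)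
qed

text \<open>Since \<open>block_end (Suc k)\<close> is the fourth power of
  \<open>block_end k\<close>, almost surely \<open>bad k\<close> puts the walk at the end of the
  block below \<open>\<sigma>\<close> times the square root of the time, and
  \<open>prob_Z_small\<close> applies.\<close>

lemma prob_bad:
  obtains \<rho> k0 where "0 \<le> \<rho>" "\<rho> < 1" "\<And>k. k0 \<le> k \<Longrightarrow> prob (bad k) \<le> \<rho>"
proof -
  obtain \<rho> n0 where \<rho>: "0 \<le> \<rho>" "\<rho> < 1"
    and small: "\<And>n. n0 \<le> n \<Longrightarrow> prob {\<omega> \<in> space M. Z n \<omega> \<le> \<sigma> * sqrt (real n)} \<le> \<rho>"
    by (rule prob_Z_small) blast
  have "prob (bad k) \<le> \<rho>" if "n0 \<le> k" for k
  proof -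
    have "sqrt (real (block_end (Suc k))) = (real (block_end k))\<^sup>2"
      by (rule real_sqrt_unique) (auto simp: block_end_Suc power_mult[symmetric])
    moreover have "k \<le> block_end (Suc k)"
    proof -
      have "k < 2 ^ k" by (rule less_exp)
      also have "(2 :: nat) ^ k \<le> 4 ^ Suc k"
        by (rule order_trans[OF power_mono[of 2 4]]) auto
      also have "(4 :: nat) ^ Suc k < 2 ^ 4 ^ Suc k" by (rule less_exp)
      finally show ?thesis by (simp add: block_end_def)
    qed
    moreover have "prob (bad k) \<le> prob {\<omega> \<in> space M. Z (block_end (Suc k)) \<omega> \<le> \<sigma> * (real (block_end k))\<^sup>2}"
    proof (rule finite_measure_mono_AE)
      show "AE \<omega> in M. \<omega> \<in> bad k \<longrightarrow> \<omega> \<in> {\<omega> \<in> space M. Z (block_end (Suc k)) \<omega> \<le> \<sigma> * (real (block_end k))\<^sup>2}"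
        using all_bounded
      proof eventually_elim
        case (elim \<omega>)
        have "Z (block_end k) \<omega> \<le> C * real (block_end k)"
          using Z_le[OF elim, of "block_end k"] by linarith
        then show ?case unfolding Z_block by (auto simp: bad_def)
      qed
    qed measurable
    ultimately show ?thesis using small[of "block_end (Suc k)"] that by (simp del: of_nat_power)
  qed
  with \<rho> that show ?thesis by blast
qed

text \<open>Sums over disjoint blocks are independent.\<close>

lemma prob_all_bad: "prob (\<Inter>k\<in>{K..<2 * K}. bad k) = (\<Prod>k\<in>{K..<2 * K}. prob (bad k))" if "0 < K"
proof -
  have "indep_vars (\<lambda>k. PiM (block k) (\<lambda>_. borel)) (\<lambda>k \<omega>. restrict (\<lambda>i. Y i \<omega>) (block k)) UNIV"
  proof (rule indep_vars_restrict[OF indep])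
    have "block j \<inter> block k = {}" if "j < k" for j k
      using block_end_mono[of "Suc j" k] that by (auto simp: block_def)
    then show "disjoint_family_on block UNIV"
      by (auto simp: disjoint_family_on_def) (metis Int_commute disjoint_iff nat_neq_iff)
  qed simp
  then have "indep_vars (\<lambda>_. borel) (\<lambda>k \<omega>. (\<lambda>y. \<Sum>i\<in>block k. y i) (restrict (\<lambda>i. Y i \<omega>) (block k))) UNIV"
    by (rule indep_vars_compose2) measurable
  moreover have "(\<lambda>k \<omega>. (\<lambda>y. \<Sum>i\<in>block k. y i) (restrict (\<lambda>i. Y i \<omega>) (block k))) = (\<lambda>k \<omega>. \<Sum>i\<in>block k. Y i \<omega>)"
    by (intro ext sum.cong) auto
  ultimately have "indep_vars (\<lambda>_. borel) (\<lambda>k \<omega>. \<Sum>i\<in>block k. Y i \<omega>) UNIV" by simp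
  then have ind: "indep_vars (\<lambda>_. borel) (\<lambda>k \<omega>. \<Sum>i\<in>block k. Y i \<omega>) {K..<2 * K}"
    by (rule indep_vars_subset) simp
  have "bad k = (\<lambda>\<omega>. \<Sum>i\<in>block k. Y i \<omega>) -` {..\<sigma> * (real (block_end k))\<^sup>2 - C * real (block_end k)} \<inter> space M" for k
    by (auto simp: bad_def)
  then show ?thesis using indep_varsD_finite[OF ind, of "\<lambda>k. {..\<sigma> * (real (block_end k))\<^sup>2 - C * real (block_end k)}"] that
    by simp
qed

text \<open>All \<open>K\<close> blocks are bad with probability at most \<open>\<rho> ^ K\<close>
  for large \<open>K\<close>, which is summable; Borel-Cantelli applies.\<close>

lemma eventually_good_block: "AE \<omega> in M. eventually (\<lambda>K. \<exists>k\<in>{K..<2 * K}. \<omega> \<in> space M - bad k) sequentially"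
proof -
  obtain \<rho> k0 where \<rho>: "0 \<le> \<rho>" "\<rho> < 1" and bd: "\<And>k. k0 \<le> k \<Longrightarrow> prob (bad k) \<le> \<rho>"
    by (rule prob_bad) blast
  \<comment> \<open>For \<open>K = 0\<close> the empty intersection would be \<open>UNIV\<close>,
    which need not be an event; the default \<open>{}\<close> does not affect the limit.\<close>
  define A where "A K = (if K = 0 then {} else \<Inter>k\<in>{K..<2 * K}. bad k)" for K
  have "AE \<omega> in M. eventually (\<lambda>K. \<omega> \<in> space M - A K) sequentially"
  proof (rule borel_cantelli_AE1)
    show "A K \<in> events" for K by (auto simp: A_def)
    show "emeasure M (A K) < \<infinity>" for K by (simp add: emeasure_eq_measure)
    show "summable (\<lambda>K. prob (A K))"
    proof (rule summable_comparison_test[OF _ summable_geometric[of \<rho>]])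
      have "prob (A K) \<le> \<rho> ^ K" if "max 1 k0 \<le> K" for K
      proof -
        have "prob (A K) = (\<Prod>k\<in>{K..<2 * K}. prob (bad k))"
          using that prob_all_bad[of K] by (simp add: A_def)
        also have "\<dots> \<le> (\<Prod>k\<in>{K..<2 * K}. \<rho>)" by (rule prod_mono) (use that bd in auto)
        finally show ?thesis by simp
      qed
      then show "\<exists>N. \<forall>K\<ge>N. norm (prob (A K)) \<le> \<rho> ^ K"
        by (intro exI[of _ "max 1 k0"]) auto
    qed (use \<rho> in simp)
  qed
  then show ?thesis
  proof eventually_elim
    case (elim \<omega>)
    then show ?case using eventually_gt_at_top[of 0]
      by eventually_elim (auto simp: A_def)
  qed
qed

lemma block_end_tendsto: "filterlim (\<lambda>k. real (block_end k)) at_top sequentially"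
proof (rule filterlim_at_top_mono[OF filterlim_real_sequentially])
  have "k \<le> block_end k" for k
  proof -
    have "k < 2 ^ k" by (rule less_exp)
    also have "(2 :: nat) ^ k \<le> 4 ^ k" by (rule power_mono) auto
    also have "(4 :: nat) ^ k < 2 ^ 4 ^ k" by (rule less_exp)
    finally show ?thesis by (simp add: block_end_def)
  qed
  then show "eventually (\<lambda>k. real k \<le> real (block_end k)) sequentially" by simp
qed

text \<open>With \<open>x = 4 ^ K\<close> the logarithm is at most \<open>16 * x\<^sup>2\<close>,
  whereas \<open>block_end K = 2 ^ x\<close>.\<close>

lemma ln_block_end_le: "eventually (\<lambda>K. 2 * ln (real (block_end (2 * Suc K))) \<le> real (block_end K)) sequentially"
proof -
  have sq: "32 * (real x)\<^sup>2 \<le> 2 ^ x" if "16 \<le> x" for x :: nat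
    using that
  proof (induction x rule: dec_induct)
    case (step x)
    have "32 * (real (Suc x))\<^sup>2 \<le> 2 * (32 * (real x)\<^sup>2)"
    proof -
      have "16 * real x \<le> real x * real x" using step by (intro mult_right_mono) auto
      then have "2 * real x + 1 \<le> real x * real x" using step by linarith
      then show ?thesis by (simp add: power2_eq_square algebra_simps)
    qed
    with step show ?case by simp
  qed simp
  have "2 * ln (real (block_end (2 * Suc K))) \<le> real (block_end K)" if "2 \<le> K" for K
  proof -
    have x: "(16 :: nat) \<le> 4 ^ K" using power_increasing[OF that, of "4 :: nat"] by simp
    have "ln (real (block_end (2 * Suc K))) = 4 ^ (2 * Suc K) * ln 2"
      by (simp add: block_end_def ln_realpow)
    also have "\<dots> \<le> 4 ^ (2 * Suc K) * 1" using ln_2_less_1 by (intro mult_left_mono) auto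
    also have "(4 :: real) ^ (2 * Suc K) = 16 * (real (4 ^ K))\<^sup>2"
      by (simp add: power_mult power2_eq_square flip: power_mult_distrib)
    finally have "2 * ln (real (block_end (2 * Suc K))) \<le> 32 * (real (4 ^ K))\<^sup>2" by simp
    also have "\<dots> \<le> 2 ^ 4 ^ K" by (rule sq[OF x])
    finally show ?thesis by (simp add: block_end_def)
  qed
  then show ?thesis by (auto simp: eventually_sequentially)
qed

text \<open>For \<open>n\<close> between \<open>block_end (2 * K)\<close> and
  \<open>block_end (2 * Suc K)\<close>, a good block \<open>k\<close> with
  \<open>K \<le> k < 2 * K\<close> ends no later than \<open>n\<close>. The walk is there at least
  \<open>block_end k\<close>, which exceeds \<open>2 * ln n\<close> by
  \<open>ln_block_end_le\<close>.\<close>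

lemma eventually_high_point:
  "AE \<omega> in M. \<exists>n0. \<forall>n\<ge>n0. \<exists>y\<in>{1..n}. 2 * ln (real n) \<le> Z y \<omega>"
  using eventually_good_block all_bounded
proof eventually_elim
  case (elim \<omega>)
  \<comment> \<open>Once \<open>\<sigma> * b \<ge> 2 * C + 1\<close>, the quadratic gain of a good
    block wins: \<open>\<sigma> * b\<^sup>2 - 2 * C * b \<ge> b\<close>.\<close>
  have "eventually (\<lambda>k. (2 * C + 1) / \<sigma> \<le> real (block_end k)) sequentially"
    using block_end_tendsto unfolding filterlim_at_top by blast
  then obtain K1 where K1: "\<And>k. K1 \<le> k \<Longrightarrow> (2 * C + 1) / \<sigma> \<le> real (block_end k)"
    by (auto simp: eventually_sequentially)
  from eventually_conj[OF ln_block_end_le elim(1)] obtain K2 where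
    K2: "\<And>K. K2 \<le> K \<Longrightarrow> 2 * ln (real (block_end (2 * Suc K))) \<le> real (block_end K) \<and>
      (\<exists>k\<in>{K..<2 * K}. \<omega> \<in> space M - bad k)"
    unfolding eventually_sequentially by blast
  define K0 where "K0 = max K1 K2"
  have "\<exists>y\<in>{1..n}. 2 * ln (real n) \<le> Z y \<omega>" if n: "block_end (2 * K0) \<le> n" for n
  proof -
    have "\<exists>K. n < block_end (2 * Suc K)"
    proof -
      have "n < block_end (2 * Suc n)"
      proof -
        have "n < 2 ^ n" by (rule less_exp)
        also have "(2 :: nat) ^ n \<le> 2 ^ 4 ^ (2 * Suc n)"
        proof (rule power_increasing)
          have "n < 2 ^ n" by (rule less_exp)
          also have "(2 :: nat) ^ n \<le> 4 ^ n" by (rule power_mono) auto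
          also have "(4 :: nat) ^ n \<le> 4 ^ (2 * Suc n)" by (rule power_increasing) auto
          finally show "n \<le> 4 ^ (2 * Suc n)" by simp
        qed simp
        finally show ?thesis by (simp add: block_end_def)
      qed
      then show ?thesis by blast
    qed
    then obtain K where K: "n < block_end (2 * Suc K)" "\<And>j. j < K \<Longrightarrow> block_end (2 * Suc j) \<le> n"
      using exists_least_iff[of "\<lambda>K. n < block_end (2 * Suc K)"] by (auto simp: not_less)
    have KK: "K0 \<le> K"
    proof (rule ccontr)
      assume "\<not> K0 \<le> K"
      then have "block_end (2 * Suc K) \<le> block_end (2 * K0)" by (intro block_end_mono) simp
      with n K(1) show False by simp
    qed
    have Kn: "block_end (2 * K) \<le> n"
    proof (cases K)
      case 0
      then show ?thesis using KK n by simp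
    next
      case (Suc j)
      then show ?thesis using K(2)[of j] by simp
    qed
    obtain k where k: "K \<le> k" "k < 2 * K" "\<omega> \<in> space M" "\<omega> \<notin> bad k"
      using K2[of K] KK by (auto simp: K0_def)
    define b where "b = real (block_end k)"
    have b0: "0 \<le> b" by (simp add: b_def)
    have "2 * C + 1 \<le> \<sigma> * b"
      using K1[of k] k KK \<sigma>(1) by (simp add: K0_def b_def field_simps)
    then have "(2 * C + 1) * b \<le> \<sigma> * b * b" using b0 by (intro mult_right_mono)
    moreover have "\<sigma> * b\<^sup>2 - C * b < (\<Sum>i\<in>block k. Y i \<omega>)"
      using k by (auto simp: bad_def b_def not_le)
    moreover have "- (C * b) \<le> Z (block_end k) \<omega>"
      using Z_le[OF elim(2), of "block_end k"] by (simp add: b_def abs_le_iff)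
    ultimately have "b \<le> Z (block_end (Suc k)) \<omega>"
      unfolding Z_block by (simp add: power2_eq_square algebra_simps)
    moreover have "2 * ln (real n) \<le> b"
    proof -
      have "0 < block_end (2 * K)" by (simp add: block_end_def)
      then have n1: "1 \<le> n" using Kn by linarith
      have "2 * ln (real n) \<le> 2 * ln (real (block_end (2 * Suc K)))" using K(1) n1 by simp
      also have "\<dots> \<le> real (block_end K)" using K2[of K] KK by (simp add: K0_def)
      also have "\<dots> \<le> b" using block_end_mono[OF k(1)] by (simp add: b_def)
      finally show ?thesis .
    qed
    moreover have "block_end (Suc k) \<in> {1..n}"
    proof -
      have "block_end (Suc k) \<le> block_end (2 * K)" using k by (intro block_end_mono) simp
      moreover have "1 \<le> block_end (Suc k)" by (simp add: block_end_def)
      ultimately show ?thesis using Kn by simp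
    qed
    ultimately show ?thesis by (intro bexI[of _ "block_end (Suc k)"]) auto
  qed
  then show ?case by blast
qed

end

section \<open>Random environments\<close>

text \<open>Passes from ratios indexed by the integers to a function of the ratios along a sequence
  of levels, used once for each side of \<open>0\<close>.\<close>

lemma (in prob_space) bounded_iid_reindex:
  fixes R :: "'i \<Rightarrow> 'a \<Rightarrow> real" and f :: "nat \<Rightarrow> 'i"
  assumes indep: "indep_vars (\<lambda>_. borel) R UNIV"
    and ident: "\<And>n. distr M borel (R n) = distr M borel (R i0)"
    and f: "inj f" and g [measurable]: "g \<in> borel_measurable borel"
    and C: "0 < C" "\<And>n. AE \<omega> in M. \<bar>g (R n \<omega>)\<bar> \<le> C"
  shows "bounded_iid M (\<lambda>i \<omega>. g (R (f i) \<omega>)) C"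
    and "expectation (\<lambda>\<omega>. g (R n \<omega>)) = expectation (\<lambda>\<omega>. g (R i0 \<omega>))"
proof -
  have [measurable]: "R n \<in> borel_measurable M" for n
    using indep by (simp add: indep_vars_def)
  have dist: "distr M borel (\<lambda>\<omega>. g (R n \<omega>)) = distr (distr M borel (R i0)) borel g" for n
    unfolding ident[of n, symmetric] by (simp add: distr_distr o_def)
  show "bounded_iid M (\<lambda>i \<omega>. g (R (f i) \<omega>)) C"
  proof
    \<comment> \<open>Reindexing along the injective \<open>f\<close> is a grouping of the variables
      into the disjoint singletons \<open>{f i}\<close>.\<close>
    have "indep_vars (\<lambda>i. PiM {f i} (\<lambda>_. borel)) (\<lambda>i \<omega>. restrict (\<lambda>j. R j \<omega>) {f i}) UNIV"
      by (rule indep_vars_restrict[OF indep]) (use f in \<open>auto simp: disjoint_family_on_def inj_def\<close>)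
    then have "indep_vars (\<lambda>_. borel) (\<lambda>i \<omega>. (restrict (\<lambda>j. R j \<omega>) {f i}) (f i)) UNIV"
      by (rule indep_vars_compose2) measurable
    then have "indep_vars (\<lambda>_. borel) (\<lambda>i. R (f i)) UNIV" by simp
    then show "indep_vars (\<lambda>_. borel) (\<lambda>i \<omega>. g (R (f i) \<omega>)) UNIV"
      by (rule indep_vars_compose2) measurable
  qed (use C in \<open>simp_all only: dist\<close>)
  have "expectation (\<lambda>\<omega>. g (R n \<omega>)) = (\<integral>x. x \<partial>distr M borel (\<lambda>\<omega>. g (R n \<omega>)))" for n
    by (simp add: integral_distr)
  then show "expectation (\<lambda>\<omega>. g (R n \<omega>)) = expectation (\<lambda>\<omega>. g (R i0 \<omega>))"
    by (simp only: dist)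
qed

lemma resistance_eq_exp:
  assumes "\<And>y. 0 < a y" "\<And>y. 0 < b y"
  shows "resistance a b n = exp (- (\<Sum>i<n. ln (a (int (Suc i)) / b (int (Suc i)))))"
proof (induction n)
  case (Suc n)
  have "b y / a y = exp (- ln (a y / b y))" for y
    using assms by (simp add: exp_minus field_simps)
  then show ?case by (simp only: resistance_Suc Suc sum.lessThan_Suc minus_add_distrib exp_add)
qed simp

theorem proposition1p2:
  fixes M :: "'w measure"
    and p q r :: "int \<Rightarrow> 'w \<Rightarrow> real"
    and \<mu> :: "int \<Rightarrow> 'w \<Rightarrow> (int ^ 'd::finite) pmf"
    and \<eta> :: real
  assumes "prob_space M"
    and "\<forall>n. p n \<in> borel_measurable M"
    and "\<forall>n. q n \<in> borel_measurable M"
    and "\<forall>n. r n \<in> borel_measurable M"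
    and "\<forall>n k. (\<lambda>\<omega>. pmf (\<mu> n \<omega>) k) \<in> borel_measurable M"
    and "\<forall>\<omega>\<in>space M. \<forall>n. p n \<omega> > 0 \<and> q n \<omega> > 0 \<and> r n \<omega> > 0 \<and> p n \<omega> + q n \<omega> + r n \<omega> = 1"
    and "\<eta> > 0"
    and "AE \<omega> in M. \<forall>n. min (p n \<omega>) (min (q n \<omega>) (r n \<omega>)) \<ge> \<eta>"
    and "AE \<omega> in M. \<forall>n.
           (\<lambda>k. norm (real_vec k) ^ max CARD('d) 3 * pmf (\<mu> n \<omega>) k) summable_on UNIV \<and>
           (\<Sum>\<^sub>\<infinity>k\<in>UNIV. norm (real_vec k) ^ max CARD('d) 3 * pmf (\<mu> n \<omega>) k) \<le> 1 / \<eta>"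
    and "AE \<omega> in M. \<forall>n. matrix_spectrum (second_moment_matrix (\<mu> n \<omega>)) \<subseteq> {\<eta>..}"
    and "prob_space.indep_vars M (\<lambda>_. borel) (\<lambda>n \<omega>. p n \<omega> / q n \<omega>) UNIV"
    and "\<forall>n. distr M borel (\<lambda>\<omega>. p n \<omega> / q n \<omega>) = distr M borel (\<lambda>\<omega>. p 0 \<omega> / q 0 \<omega>)"
    and "prob_space.expectation M (\<lambda>\<omega>. ln (p 0 \<omega> / q 0 \<omega>)) \<noteq> 0 \<or> CARD('d) \<ge> 2"
  shows "AE \<omega> in M. \<forall>(N :: 'b measure) S.
           markov_chain N S
             (strat_trans (\<lambda>n. p n \<omega>) (\<lambda>n. q n \<omega>) (\<lambda>n. r n \<omega>) (\<lambda>n. \<mu> n \<omega>)) (0, 0)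
           \<longrightarrow> transient_at N S (0, 0)"
proof -
  interpret prob_space M by fact
  define R where "R n \<omega> = p n \<omega> / q n \<omega>" for n \<omega>
  \<comment> \<open>Almost surely \<open>p\<close> and \<open>q\<close> lie between
    \<open>\<eta>\<close> and \<open>1\<close>, so \<open>\<bar>ln \<eta>\<bar>\<close> bounds the
    log ratios; the summand \<open>1\<close> makes \<open>C\<close> positive.\<close>
  define C where "C = 1 + \<bar>ln \<eta>\<bar>"
  have C: "0 < C" by (simp add: C_def)
  have env: "stratified_environment (\<lambda>n. p n \<omega>) (\<lambda>n. q n \<omega>) (\<lambda>n. r n \<omega>)" if "\<omega> \<in> space M" for \<omega>
    using assms(6) that by unfold_locales auto
  have bound: "AE \<omega> in M. \<bar>ln (R n \<omega>)\<bar> \<le> C" for n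
    using assms(8) AE_space
  proof eventually_elim
    case (elim \<omega>)
    then have pq: "\<eta> \<le> p n \<omega>" "\<eta> \<le> q n \<omega>" by auto
    have pos: "0 < p n \<omega>" "0 < q n \<omega>" "0 < r n \<omega>" "p n \<omega> + q n \<omega> + r n \<omega> = 1"
      using assms(6) elim(2) by auto
    then have "p n \<omega> \<le> 1" "q n \<omega> \<le> 1" by linarith+
    then have "ln \<eta> \<le> ln (p n \<omega>)" "ln (p n \<omega>) \<le> 0" "ln \<eta> \<le> ln (q n \<omega>)" "ln (q n \<omega>) \<le> 0"
      using pq pos assms(7) by auto
    then have "\<bar>ln (p n \<omega>) - ln (q n \<omega>)\<bar> \<le> 1 + \<bar>ln \<eta>\<bar>" by linarith
    then show ?case using pos by (simp add: R_def C_def ln_div)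
  qed
  have ind: "indep_vars (\<lambda>_. borel) R UNIV" and idd: "\<And>n. distr M borel (R n) = distr M borel (R 0)"
    using assms(11,12) by (simp_all add: R_def[abs_def])
  \<comment> \<open>Partial sums of \<open>right\<close> and \<open>left\<close> are minus the
    logarithms of the resistances on the two sides of \<open>0\<close>.\<close>
  define right where "right = (\<lambda>i \<omega>. ln (R (int (Suc i)) \<omega>))"
  define left where "left = (\<lambda>i \<omega>. - ln (R (- int (Suc i)) \<omega>))"
  have "inj (\<lambda>i. int (Suc i))" "inj (\<lambda>i. - int (Suc i))" by (auto simp: inj_on_def)
  note inj = this
  note iid_right = bounded_iid_reindex[OF ind idd inj(1) _ C bound]
  have "AE \<omega> in M. \<bar>- ln (R n \<omega>)\<bar> \<le> C" for n using bound by simp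
  note iid_left = bounded_iid_reindex[OF ind idd inj(2) _ C this]
  interpret right: bounded_iid M right C
    unfolding right_def by (rule iid_right) measurable
  interpret left: bounded_iid M left C
    unfolding left_def by (rule iid_left) measurable
  define m where "m = expectation (\<lambda>\<omega>. ln (R 0 \<omega>))"
  have Eright: "expectation (right 0) = m"
    unfolding right_def m_def by (rule iid_right) measurable
  have Eleft: "expectation (left 0) = - m"
  proof -
    have "expectation (left 0) = expectation (\<lambda>\<omega>. - ln (R 0 \<omega>))"
      unfolding left_def by (rule iid_left) measurable
    then show ?thesis by (simp add: m_def)
  qed
  have res_right: "resistance (\<lambda>n. p n \<omega>) (\<lambda>n. q n \<omega>) = (\<lambda>n. exp (- right.Z n \<omega>))" if "\<omega> \<in> space M" for \<omega>
  proof
    fix n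
    have "right.Z n \<omega> = (\<Sum>i<n. ln (p (int (Suc i)) \<omega> / q (int (Suc i)) \<omega>))"
      unfolding right.Z_def by (simp add: right_def R_def)
    then show "resistance (\<lambda>n. p n \<omega>) (\<lambda>n. q n \<omega>) n = exp (- right.Z n \<omega>)"
      using assms(6) that by (subst resistance_eq_exp) auto
  qed
  have res_left: "resistance (\<lambda>n. q (- n) \<omega>) (\<lambda>n. p (- n) \<omega>) = (\<lambda>n. exp (- left.Z n \<omega>))"
    if "\<omega> \<in> space M" for \<omega>
  proof
    fix n
    have "- ln (p y \<omega> / q y \<omega>) = ln (q y \<omega> / p y \<omega>)" for y
      using assms(6) that by (simp add: ln_div)
    then have "left.Z n \<omega> = (\<Sum>i<n. ln (q (- int (Suc i)) \<omega> / p (- int (Suc i)) \<omega>))"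
      unfolding left.Z_def by (simp add: left_def R_def)
    then show "resistance (\<lambda>n. q (- n) \<omega>) (\<lambda>n. p (- n) \<omega>) n = exp (- left.Z n \<omega>)"
      using assms(6) that by (subst resistance_eq_exp) auto
  qed
  \<comment> \<open>A nonzero mean makes the resistances almost surely summable on one side; for
    mean \<open>0\<close> the horizontal spreading in at least two dimensions takes over.\<close>
  consider "0 < m" | "m < 0" | "m = 0" "2 \<le> CARD('d)"
    using assms(13) unfolding m_def R_def by linarith
  then show ?thesis
  proof cases
    case 1
    have "AE \<omega> in M. summable (\<lambda>n. exp (- right.Z n \<omega>))"
      by (rule right.summable_exp_neg_Z) (simp add: Eright 1)
    then show ?thesis
      using AE_space
    proof eventually_elim
      case (elim \<omega>)
      interpret stratified_environment "\<lambda>n. p n \<omega>" "\<lambda>n. q n \<omega>" "\<lambda>n. r n \<omega>" "\<lambda>n. \<mu> n \<omega>"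
        by (rule env) fact
      have sm: "summable (resistance (\<lambda>n. p n \<omega>) (\<lambda>n. q n \<omega>))"
        using elim by (simp add: res_right)
      show ?case by (intro allI impI) (rule transient_if_right_resistance[OF sm])
    qed
  next
    case 2
    have "AE \<omega> in M. summable (\<lambda>n. exp (- left.Z n \<omega>))"
      by (rule left.summable_exp_neg_Z) (simp add: Eleft 2)
    then show ?thesis
      using AE_space
    proof eventually_elim
      case (elim \<omega>)
      interpret stratified_environment "\<lambda>n. p n \<omega>" "\<lambda>n. q n \<omega>" "\<lambda>n. r n \<omega>" "\<lambda>n. \<mu> n \<omega>"
        by (rule env) fact
      have sm: "summable (resistance (\<lambda>n. q (- n) \<omega>) (\<lambda>n. p (- n) \<omega>))"
        using elim by (simp add: res_left)
      show ?case by (intro allI impI) (rule transient_if_left_resistance[OF sm])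
    qed
  next
    case 3
    \<comment> \<open>The constants are quantified inside the almost sure event because
      \<open>c\<close> will be \<open>p 0 \<omega>\<close>, which depends on
      \<open>\<omega>\<close>.\<close>
    have "AE \<omega> in M. \<forall>c \<kappa>. 0 < \<kappa> \<longrightarrow> multiscale_bound c \<kappa> (\<lambda>n. exp (- right.Z n \<omega>))"
    proof (cases "expectation (\<lambda>\<omega>. (right 0 \<omega>)\<^sup>2) = 0")
      case True
      \<comment> \<open>With zero second moment all log ratios on the right vanish, so every
        resistance equals \<open>1\<close>.\<close>
      from right.degenerate[OF this] show ?thesis
        by eventually_elim (simp add: right.Z_def multiscale_bound_flat)
    next
      case False
      moreover have "0 \<le> expectation (\<lambda>\<omega>. (right 0 \<omega>)\<^sup>2)" by (intro Bochner_Integration.integral_nonneg zero_le_power2)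
      ultimately have var: "0 < expectation (\<lambda>\<omega>. (right 0 \<omega>)\<^sup>2)" by linarith
      have mean: "expectation (right 0) = 0" using Eright 3(1) by simp
      interpret right: centered_bounded_iid M right C
        by (intro centered_bounded_iid.intro centered_bounded_iid_axioms.intro
            right.bounded_iid_axioms mean var)
      \<comment> \<open>\<open>Z n \<ge> - C * n\<close> bounds the resistances by
        \<open>exp C ^ n\<close>, hence by \<open>(2 ^ l) ^ n\<close>.\<close>
      obtain l where l: "exp C < 2 ^ l" using real_arch_pow[of 2 "exp C"] by auto
      then have l1: "1 \<le> l" using C by (cases l) auto
      show ?thesis
        using right.eventually_high_point right.all_bounded
      proof eventually_elim
        case (elim \<omega>)
        then obtain n0 where n0: "\<And>n. n0 \<le> n \<Longrightarrow> \<exists>y\<in>{1..n}. 2 * ln (real n) \<le> right.Z y \<omega>" by blast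
        show ?case
        proof (intro allI impI)
          fix c \<kappa> :: real assume "0 < \<kappa>"
          then show "multiscale_bound c \<kappa> (\<lambda>n. exp (- right.Z n \<omega>))"
          proof (rule multiscale_bound_valley[OF _ l1])
            fix n
            have "exp (- right.Z n \<omega>) \<le> exp (real n * C)"
              using right.Z_le[OF elim(2), of n] by (simp add: abs_le_iff mult.commute)
            also have "\<dots> = exp C ^ n" by (rule exp_of_nat_mult)
            also have "\<dots> \<le> (2 ^ l) ^ n" using l by (intro power_mono) auto
            finally show "exp (- right.Z n \<omega>) \<le> (2 ^ l) ^ n" .
          next
            fix n assume n: "max 1 n0 \<le> n"
            then obtain y where y: "y \<in> {1..n}" "2 * ln (real n) \<le> right.Z y \<omega>" using n0[of n] by auto
            have "exp (- right.Z y \<omega>) \<le> exp (- (2 * ln (real n)))" using y by simp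
            also have "\<dots> = 1 / (real n)\<^sup>2"
              using n by (simp add: exp_minus exp_double divide_inverse)
            finally show "\<exists>y\<in>{1..n}. exp (- right.Z y \<omega>) \<le> 1 / (real n)\<^sup>2" using y by blast
          qed simp
        qed
      qed
    qed
    then show ?thesis
      using assms(8,9,10) AE_space
    proof eventually_elim
      case (elim \<omega>)
      interpret stratified_environment "\<lambda>n. p n \<omega>" "\<lambda>n. q n \<omega>" "\<lambda>n. r n \<omega>" "\<lambda>n. \<mu> n \<omega>"
        by (rule env) fact
      show ?case
      proof (intro allI impI)
        fix N :: "'b measure" and S
        assume "markov_chain N S
          (strat_trans (\<lambda>n. p n \<omega>) (\<lambda>n. q n \<omega>) (\<lambda>n. r n \<omega>) (\<lambda>n. \<mu> n \<omega>)) (0, 0)"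
        then show "transient_at N S (0, 0)"
        proof (rule transient_if_multiscale_bound[OF 3(2) assms(7), rotated -1])
          show "\<eta> \<le> r y \<omega>" for y using elim(2) by simp
          show "multiscale_bound (p 0 \<omega>) \<kappa> (resistance (\<lambda>n. p n \<omega>) (\<lambda>n. q n \<omega>))" if "0 < \<kappa>" for \<kappa>
            using elim(1) that unfolding res_right[OF elim(5)] by blast
        qed (use elim(3,4) in blast)+
      qed
    qed
  qed
qed

end
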